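(* Let $(M,g)$ be an $n$-dimensional ($n>3$) weakly $Z$ symmetric manifold $(WZS)_n$ with non singular $Z$ tensor and $\omega\neq0$, where $\omega_k=A_k-B_k$. If $\nabla_mK_{jkl}{}^m=0$, where $K$ is one of the tensors $P$ (projective), $\tilde C$ (concircular), $N$ (conharmonic), then $\omega$ is a closed 1-form.
   Context: $(M,g)$ is an $n$-dimensional Riemannian manifold with Levi-Civita connection $\nabla$; index notation with summation over repeated indices; $R_{jkl}{}^m$ is the Riemann tensor, $R_{kl}=-R_{mkl}{}^m$ the Ricci tensor, $R=g^{ij}R_{ij}$ the scalar curvature. Generalized $Z$ tensor: $Z_{kl}=R_{kl}+\phi\,g_{kl}$, where $\phi$ is an arbitrary scalar function. The manifold is weakly $Z$ symmetric, $(WZS)_n$, if for some $\phi$ there are covectors $A_k,B_k,D_k$ with $$\nabla_kZ_{jl}=A_kZ_{jl}+B_jZ_{kl}+D_lZ_{kj}.$$ The $Z$ tensor is non singular if there is a $(2,0)$ tensor $Z^{-1}$ with $(Z^{-1})^{kh}Z_{kl}=\delta^h{}_l$. A 1-form $\omega_k$ is closed if $\nabla_i\omega_j-\nabla_j\omega_i=0$. Curvature tensors: $$P_{jkl}{}^m=R_{jkl}{}^m+\tfrac{1}{n-1}(\delta_j{}^mR_{kl}-\delta_k{}^mR_{jl}),$$ $$\tilde C_{jkl}{}^m=R_{jkl}{}^m+\tfrac{R}{n(n-1)}(\delta_j{}^mg_{kl}-\delta_k{}^mg_{jl}),$$ $$N_{jkl}{}^m=R_{jkl}{}^m+\tfrac{1}{n-2}(\delta_j{}^mR_{kl}-\delta_k{}^mR_{jl}+R_j{}^mg_{kl}-R_k{}^mg_{jl}).$$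 *)

theory Defs
  imports "HOL-Analysis.Analysis"
begin

section \<open>Smooth functions on open subsets of Euclidean space\<close>

primrec Ck_on :: "nat \<Rightarrow> (real ^ 'n) set \<Rightarrow> (real ^ 'n \<Rightarrow> real) \<Rightarrow> bool" where
  "Ck_on 0 S f \<longleftrightarrow> continuous_on S f"
| "Ck_on (Suc k) S f \<longleftrightarrow>
     (\<forall>x\<in>S. f differentiable (at x)) \<and>
     (\<forall>i. Ck_on k S (\<lambda>x. frechet_derivative f (at x) (axis i 1)))"

definition smooth_on :: "(real ^ 'n) set \<Rightarrow> (real ^ 'n \<Rightarrow> real) \<Rightarrow> bool" where
  "smooth_on S f \<longleftrightarrow> (\<forall>k. Ck_on k S f)"


section \<open>Smooth manifolds\<close>

text \<open>A chart is a pair of a domain and a coordinate map. Values of the coordinate map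
  outside the domain are irrelevant.\<close>

type_synonym ('a, 'n) chart = "'a set \<times> ('a \<Rightarrow> real ^ 'n)"

definition is_chart :: "'a topology \<Rightarrow> ('a, 'n::finite) chart \<Rightarrow> bool" where
  "is_chart X c \<longleftrightarrow>
     openin X (fst c) \<and> open (snd c ` fst c) \<and>
     homeomorphic_map (subtopology X (fst c)) (top_of_set (snd c ` fst c)) (snd c)"

definition chart_rep :: "('a, 'n::finite) chart \<Rightarrow> ('a \<Rightarrow> real) \<Rightarrow> real ^ 'n \<Rightarrow> real" where
  "chart_rep c f = (\<lambda>x. f (inv_into (fst c) (snd c) x))"

definition smooth_in_chart :: "('a, 'n::finite) chart \<Rightarrow> ('a \<Rightarrow> real) \<Rightarrow> bool" where
  "smooth_in_chart c f \<longleftrightarrow> smooth_on (snd c ` fst c) (chart_rep c f)"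

text \<open>The atlas is not required to be maximal: tensor fields given compatibly on the charts
  of an atlas are the same thing as tensor fields for the maximal atlas it generates.
  The topology is not required to be connected.\<close>

definition smooth_manifold :: "'a topology \<Rightarrow> ('a, 'n::finite) chart set \<Rightarrow> bool" where
  "smooth_manifold X Atl \<longleftrightarrow>
     Hausdorff_space X \<and> second_countable X \<and>
     (\<forall>c\<in>Atl. is_chart X c) \<and> (\<Union>c\<in>Atl. fst c) = topspace X \<and>
     (\<forall>c\<in>Atl. \<forall>d\<in>Atl. \<forall>a.
        smooth_on (snd c ` (fst c \<inter> fst d)) (chart_rep c (\<lambda>p. snd d p $ a)))"

text \<open>The partial derivative of \<open>f\<close> at \<open>p\<close> along the \<open>i\<close>-th coordinate of the chart \<open>c\<close>.\<close>

definition pd :: "('a, 'n::finite) chart \<Rightarrow> 'n \<Rightarrow> ('a \<Rightarrow> real) \<Rightarrow> 'a \<Rightarrow> real" where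
  "pd c i f p = frechet_derivative (chart_rep c f) (at (snd c p)) (axis i 1)"

text \<open>\<open>jac d c a i\<close> is the derivative of the \<open>a\<close>-th coordinate of \<open>d\<close> with respect to the
  \<open>i\<close>-th coordinate of \<open>c\<close>.\<close>

definition jac :: "('a, 'n::finite) chart \<Rightarrow> ('a, 'n) chart \<Rightarrow> 'n \<Rightarrow> 'n \<Rightarrow> 'a \<Rightarrow> real" where
  "jac d c a i p = pd c i (\<lambda>q. snd d q $ a) p"


section \<open>Tensor fields in index notation\<close>

text \<open>A tensor field is a family of components, indexed by the chart, the indices and the point
  of the manifold. The components are smooth in every chart and obey the tensor transformation
  law on overlaps; values at points outside the domain of the chart are irrelevant.\<close>

type_synonym ('a, 'n) tensor1 = "('a, 'n) chart \<Rightarrow> 'n \<Rightarrow> 'a \<Rightarrow> real"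
type_synonym ('a, 'n) tensor2 = "('a, 'n) chart \<Rightarrow> 'n \<Rightarrow> 'n \<Rightarrow> 'a \<Rightarrow> real"
type_synonym ('a, 'n) tensor4 = "('a, 'n) chart \<Rightarrow> 'n \<Rightarrow> 'n \<Rightarrow> 'n \<Rightarrow> 'n \<Rightarrow> 'a \<Rightarrow> real"

definition scalar_field :: "('a, 'n::finite) chart set \<Rightarrow> ('a \<Rightarrow> real) \<Rightarrow> bool" where
  "scalar_field Atl f \<longleftrightarrow> (\<forall>c\<in>Atl. smooth_in_chart c f)"

definition covector_field :: "('a, 'n::finite) chart set \<Rightarrow> ('a, 'n) tensor1 \<Rightarrow> bool" where
  "covector_field Atl w \<longleftrightarrow>
     (\<forall>c\<in>Atl. \<forall>i. smooth_in_chart c (w c i)) \<and>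
     (\<forall>c\<in>Atl. \<forall>d\<in>Atl. \<forall>p\<in>fst c \<inter> fst d. \<forall>i.
        w c i p = (\<Sum>a\<in>UNIV. jac d c a i p * w d a p))"

definition tensor_field_0_2 :: "('a, 'n::finite) chart set \<Rightarrow> ('a, 'n) tensor2 \<Rightarrow> bool" where
  "tensor_field_0_2 Atl T \<longleftrightarrow>
     (\<forall>c\<in>Atl. \<forall>i j. smooth_in_chart c (T c i j)) \<and>
     (\<forall>c\<in>Atl. \<forall>d\<in>Atl. \<forall>p\<in>fst c \<inter> fst d. \<forall>i j.
        T c i j p = (\<Sum>a\<in>UNIV. \<Sum>b\<in>UNIV. jac d c a i p * jac d c b j p * T d a b p))"

definition tensor_field_2_0 :: "('a, 'n::finite) chart set \<Rightarrow> ('a, 'n) tensor2 \<Rightarrow> bool" where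
  "tensor_field_2_0 Atl T \<longleftrightarrow>
     (\<forall>c\<in>Atl. \<forall>i j. smooth_in_chart c (T c i j)) \<and>
     (\<forall>c\<in>Atl. \<forall>d\<in>Atl. \<forall>p\<in>fst c \<inter> fst d. \<forall>i j.
        T c i j p = (\<Sum>a\<in>UNIV. \<Sum>b\<in>UNIV. jac c d i a p * jac c d j b p * T d a b p))"

definition kdelta :: "'n \<Rightarrow> 'n \<Rightarrow> real" where
  "kdelta i j = (if i = j then 1 else 0)"


section \<open>Riemannian metrics and the Levi-Civita connection\<close>

definition riemannian_manifold ::
  "'a topology \<Rightarrow> ('a, 'n::finite) chart set \<Rightarrow> ('a, 'n) tensor2 \<Rightarrow> bool" where
  "riemannian_manifold X Atl g \<longleftrightarrow>
     smooth_manifold X Atl \<and> tensor_field_0_2 Atl g \<and>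
     (\<forall>c\<in>Atl. \<forall>p\<in>fst c.
        (\<forall>i j. g c i j p = g c j i p) \<and>
        (\<forall>v::real ^ 'n. v \<noteq> 0 \<longrightarrow> (\<Sum>i\<in>UNIV. \<Sum>j\<in>UNIV. g c i j p * v $ i * v $ j) > 0))"

definition ginv :: "('a, 'n::finite) tensor2 \<Rightarrow> ('a, 'n) tensor2" where
  "ginv g c i j p = matrix_inv (\<chi> a b. g c a b p) $ i $ j"

text \<open>\<open>christoffel g c m i j p\<close> has \<open>m\<close> as its upper index.\<close>

definition christoffel ::
  "('a, 'n::finite) tensor2 \<Rightarrow> ('a, 'n) chart \<Rightarrow> 'n \<Rightarrow> 'n \<Rightarrow> 'n \<Rightarrow> 'a \<Rightarrow> real" where
  "christoffel g c m i j p =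
     1/2 * (\<Sum>s\<in>UNIV. ginv g c m s p *
              (pd c i (g c j s) p + pd c j (g c i s) p - pd c s (g c i j) p))"

text \<open>Covariant derivatives of covector fields, of \<open>(0,2)\<close> tensor fields and of tensor fields
  \<open>K\<^sub>j\<^sub>k\<^sub>l\<^sup>m\<close> (written \<open>K c j k l m\<close>). The differentiation index comes first.\<close>

definition nabla1 ::
  "('a, 'n::finite) tensor2 \<Rightarrow> ('a, 'n) tensor1 \<Rightarrow> ('a, 'n) tensor2" where
  "nabla1 g w c i j p = pd c i (w c j) p - (\<Sum>s\<in>UNIV. christoffel g c s i j p * w c s p)"

definition nabla2 ::
  "('a, 'n::finite) tensor2 \<Rightarrow> ('a, 'n) tensor2 \<Rightarrow> ('a, 'n) chart \<Rightarrow> 'n \<Rightarrow> 'n \<Rightarrow> 'n \<Rightarrow> 'a \<Rightarrow> real" where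
  "nabla2 g T c k j l p =
     pd c k (T c j l) p
     - (\<Sum>s\<in>UNIV. christoffel g c s k j p * T c s l p)
     - (\<Sum>s\<in>UNIV. christoffel g c s k l p * T c j s p)"

definition nabla4 ::
  "('a, 'n::finite) tensor2 \<Rightarrow> ('a, 'n) tensor4 \<Rightarrow>
   ('a, 'n) chart \<Rightarrow> 'n \<Rightarrow> 'n \<Rightarrow> 'n \<Rightarrow> 'n \<Rightarrow> 'n \<Rightarrow> 'a \<Rightarrow> real" where
  "nabla4 g K c i j k l m p =
     pd c i (K c j k l m) p
     - (\<Sum>s\<in>UNIV. christoffel g c s i j p * K c s k l m p)
     - (\<Sum>s\<in>UNIV. christoffel g c s i k p * K c j s l m p)
     - (\<Sum>s\<in>UNIV. christoffel g c s i l p * K c j k s m p)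
     + (\<Sum>s\<in>UNIV. christoffel g c m i s p * K c j k l s p)"

definition divergence_free ::
  "('a, 'n::finite) chart set \<Rightarrow> ('a, 'n) tensor2 \<Rightarrow> ('a, 'n) tensor4 \<Rightarrow> bool" where
  "divergence_free Atl g K \<longleftrightarrow>
     (\<forall>c\<in>Atl. \<forall>p\<in>fst c. \<forall>j k l. (\<Sum>m\<in>UNIV. nabla4 g K c m j k l m p) = 0)"

definition closed_1form ::
  "('a, 'n::finite) chart set \<Rightarrow> ('a, 'n) tensor2 \<Rightarrow> ('a, 'n) tensor1 \<Rightarrow> bool" where
  "closed_1form Atl g w \<longleftrightarrow>
     (\<forall>c\<in>Atl. \<forall>p\<in>fst c. \<forall>i j. nabla1 g w c i j p - nabla1 g w c j i p = 0)"


section \<open>Curvature\<close>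

text \<open>Sign convention: \<open>(\<nabla>\<^sub>j \<nabla>\<^sub>k - \<nabla>\<^sub>k \<nabla>\<^sub>j) X\<^sub>l = R\<^sub>j\<^sub>k\<^sub>l\<^sup>m X\<^sub>m\<close> for covectors. Together with
  \<open>R\<^sub>k\<^sub>l = - R\<^sub>m\<^sub>k\<^sub>l\<^sup>m\<close> it makes the Ricci tensor of a round sphere positive.\<close>

definition riemann :: "('a, 'n::finite) tensor2 \<Rightarrow> ('a, 'n) tensor4" where
  "riemann g c j k l m p =
     pd c k (christoffel g c m j l) p - pd c j (christoffel g c m k l) p
     + (\<Sum>s\<in>UNIV. christoffel g c s j l p * christoffel g c m k s p
               - christoffel g c s k l p * christoffel g c m j s p)"

definition ricci :: "('a, 'n::finite) tensor2 \<Rightarrow> ('a, 'n) tensor2" where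
  "ricci g c k l p = - (\<Sum>m\<in>UNIV. riemann g c m k l m p)"

text \<open>\<open>ricci_mixed g c j m\<close> is \<open>R\<^sub>j\<^sup>m\<close>.\<close>

definition ricci_mixed :: "('a, 'n::finite) tensor2 \<Rightarrow> ('a, 'n) tensor2" where
  "ricci_mixed g c j m p = (\<Sum>s\<in>UNIV. ginv g c m s p * ricci g c j s p)"

definition scalar_curv :: "('a, 'n::finite) tensor2 \<Rightarrow> ('a, 'n) chart \<Rightarrow> 'a \<Rightarrow> real" where
  "scalar_curv g c p = (\<Sum>i\<in>UNIV. \<Sum>j\<in>UNIV. ginv g c i j p * ricci g c i j p)"

definition projective :: "('a, 'n::finite) tensor2 \<Rightarrow> ('a, 'n) tensor4" where
  "projective g c j k l m p =
     riemann g c j k l m p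
     + 1 / (real CARD('n) - 1) * (kdelta j m * ricci g c k l p - kdelta k m * ricci g c j l p)"

definition concircular :: "('a, 'n::finite) tensor2 \<Rightarrow> ('a, 'n) tensor4" where
  "concircular g c j k l m p =
     riemann g c j k l m p
     + scalar_curv g c p / (real CARD('n) * (real CARD('n) - 1)) *
         (kdelta j m * g c k l p - kdelta k m * g c j l p)"

definition conharmonic :: "('a, 'n::finite) tensor2 \<Rightarrow> ('a, 'n) tensor4" where
  "conharmonic g c j k l m p =
     riemann g c j k l m p
     + 1 / (real CARD('n) - 2) *
         (kdelta j m * ricci g c k l p - kdelta k m * ricci g c j l p
          + ricci_mixed g c j m p * g c k l p - ricci_mixed g c k m p * g c j l p)"


section \<open>Weakly Z symmetric manifolds\<close>

definition Z_tensor :: "('a, 'n::finite) tensor2 \<Rightarrow> ('a \<Rightarrow> real) \<Rightarrow> ('a, 'n) tensor2" where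
  "Z_tensor g \<phi> c k l p = ricci g c k l p + \<phi> p * g c k l p"

definition weakly_Z_symmetric ::
  "('a, 'n::finite) chart set \<Rightarrow> ('a, 'n) tensor2 \<Rightarrow> ('a \<Rightarrow> real) \<Rightarrow>
   ('a, 'n) tensor1 \<Rightarrow> ('a, 'n) tensor1 \<Rightarrow> ('a, 'n) tensor1 \<Rightarrow> bool" where
  "weakly_Z_symmetric Atl g \<phi> A B D \<longleftrightarrow>
     scalar_field Atl \<phi> \<and>
     covector_field Atl A \<and> covector_field Atl B \<and> covector_field Atl D \<and>
     (\<forall>c\<in>Atl. \<forall>p\<in>fst c. \<forall>k j l.
        nabla2 g (Z_tensor g \<phi>) c k j l p =
          A c k p * Z_tensor g \<phi> c j l p + B c j p * Z_tensor g \<phi> c k l p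
          + D c l p * Z_tensor g \<phi> c k j p)"

definition nonsingular ::
  "('a, 'n::finite) chart set \<Rightarrow> ('a, 'n) tensor2 \<Rightarrow> bool" where
  "nonsingular Atl T \<longleftrightarrow>
     (\<exists>Tinv. tensor_field_2_0 Atl Tinv \<and>
        (\<forall>c\<in>Atl. \<forall>p\<in>fst c. \<forall>h l.
           (\<Sum>k\<in>UNIV. Tinv c k h p * T c k l p) = kdelta h l))"

end

theory Submission
  imports Defs
begin

text \<open>The argument is local and takes place in a single chart. Antisymmetrizing the weak
  \<open>Z\<close> symmetry equation gives \<open>\<nabla>\<^sub>k Z\<^sub>j\<^sub>l - \<nabla>\<^sub>j Z\<^sub>k\<^sub>l = \<omega>\<^sub>k Z\<^sub>j\<^sub>l - \<omega>\<^sub>j Z\<^sub>k\<^sub>l\<close>. By the contracted second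
  Bianchi identity \<open>\<nabla>\<^sub>m R\<^sub>j\<^sub>k\<^sub>l\<^sup>m = \<nabla>\<^sub>k R\<^sub>j\<^sub>l - \<nabla>\<^sub>j R\<^sub>k\<^sub>l\<close>, the vanishing of the divergence of \<open>K\<close> makes
  the same tensor equal to \<open>f\<^sub>k g\<^sub>j\<^sub>l - f\<^sub>j g\<^sub>k\<^sub>l\<close> with \<open>f\<^sub>k\<close> the gradient of \<open>f = \<phi> + a R\<close> for a constant
  \<open>a\<close>. Viewing \<open>Z\<close> and \<open>g\<close> as 1-forms with values in covectors, this reads
  \<open>\<omega> \<and> Z = dZ = df \<and> g\<close>. The exterior covariant derivative of the right-hand side is zero,
  and that of the left-hand side is \<open>d\<omega> \<and> Z - \<omega> \<and> \<omega> \<and> Z = d\<omega> \<and> Z\<close>. Since \<open>Z\<close> is non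
  singular and the dimension is at least 3, \<open>d\<omega> = 0\<close>.\<close>

section \<open>Calculus of smooth functions on open sets\<close>

definition partial :: "'n::finite \<Rightarrow> (real ^ 'n \<Rightarrow> real) \<Rightarrow> real ^ 'n \<Rightarrow> real" where
  "partial i f x = frechet_derivative f (at x) (axis i 1)"

text \<open>Phrasing the recursion through \<open>partial\<close> makes the induction hypotheses
  apply to a named function; the defining equation is then kept out of the simplifier.\<close>

lemma Ck_on_Suc:
  "Ck_on (Suc k) S f \<longleftrightarrow> (\<forall>x\<in>S. f differentiable (at x)) \<and> (\<forall>i. Ck_on k S (partial i f))"
  by (simp add: partial_def[abs_def])

declare Ck_on.simps(2) [simp del]

text \<open>Having a given derivative at a point of an open set depends only on nearby values. Since
  \<open>frechet_derivative\<close> is a choice, the comparison is made for every candidate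
  \<open>D\<close>.\<close>

lemma partial_cong:
  assumes "open S" "x \<in> S" "\<And>y. y \<in> S \<Longrightarrow> f y = h y"
  shows "partial i f x = partial i h x"
proof -
  have "(f has_derivative D) (at x) \<longleftrightarrow> (h has_derivative D) (at x)" for D
    using assms has_derivative_transform_within_open[of f D x UNIV S h]
      has_derivative_transform_within_open[of h D x UNIV S f] by auto
  then show ?thesis
    by (simp add: partial_def frechet_derivative_def)
qed

lemma Ck_on_cong:
  assumes "open S" "\<And>y. y \<in> S \<Longrightarrow> f y = h y" "Ck_on k S f"
  shows "Ck_on k S h"
  using assms(2,3)
proof (induction k arbitrary: f h)
  case 0
  then show ?case
    by (metis Ck_on.simps(1) continuous_on_cong)
next
  case (Suc k)
  have "h differentiable (at x)" if "x \<in> S" for x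
    using Suc.prems that assms(1) has_derivative_transform_within_open[of f _ x UNIV S h]
    unfolding Ck_on_Suc differentiable_def by metis
  moreover have "Ck_on k S (partial i h)" for i
    using Suc.IH[of "partial i f" "partial i h"] partial_cong[OF assms(1), of _ f h i] Suc.prems
    by (auto simp: Ck_on_Suc)
  ultimately show ?case
    by (simp add: Ck_on_Suc)
qed

lemma Ck_on_Suc_imp_continuous_on: "Ck_on (Suc k) S f \<Longrightarrow> continuous_on S f"
  unfolding Ck_on_Suc
  by (simp add: continuous_at_imp_continuous_on differentiable_imp_continuous_within)

lemma Ck_on_SucD: "Ck_on (Suc k) S f \<Longrightarrow> Ck_on k S f"
proof (induction k arbitrary: f)
  case 0
  then show ?case using Ck_on_Suc_imp_continuous_on[of 0 S f] by simp
next
  case (Suc k)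
  then show ?case using Ck_on_Suc[of "Suc k" S f] Ck_on_Suc[of k S f] by blast
qed

lemma partial_const [simp]: "partial i (\<lambda>x. a) x = 0"
  by (simp add: partial_def)

lemma partial_add:
  assumes "f differentiable (at x)" "h differentiable (at x)"
  shows "partial i (\<lambda>y. f y + h y) x = partial i f x + partial i h x"
proof -
  have "((\<lambda>y. f y + h y) has_derivative
      (\<lambda>v. frechet_derivative f (at x) v + frechet_derivative h (at x) v)) (at x)"
    using assms by (intro has_derivative_add) (simp_all add: frechet_derivative_works)
  from frechet_derivative_at[OF this, symmetric] show ?thesis
    by (simp add: partial_def)
qed

lemma partial_mult:
  assumes "f differentiable (at x)" "h differentiable (at x)"
  shows "partial i (\<lambda>y. f y * h y) x = partial i f x * h x + f x * partial i h x"
proof -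
  have "((\<lambda>y. f y * h y) has_derivative
      (\<lambda>v. f x * frechet_derivative h (at x) v + frechet_derivative f (at x) v * h x)) (at x)"
    using assms by (intro has_derivative_mult) (simp_all add: frechet_derivative_works)
  from frechet_derivative_at[OF this, symmetric] show ?thesis
    by (simp add: partial_def)
qed

lemma partial_inverse:
  assumes "f differentiable (at x)" "f x \<noteq> 0"
  shows "partial i (\<lambda>y. inverse (f y)) x = - (inverse (f x) * partial i f x * inverse (f x))"
proof -
  have "((\<lambda>y. inverse (f y)) has_derivative
      (\<lambda>v. - (inverse (f x) * frechet_derivative f (at x) v * inverse (f x)))) (at x)"
    using assms by (intro Deriv.has_derivative_inverse) (simp_all add: frechet_derivative_works)
  from frechet_derivative_at[OF this, symmetric] show ?thesis
    by (simp add: partial_def)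
qed

section \<open>Closure of the class of k times continuously differentiable functions under algebraic
  operations\<close>

lemma Ck_on_const: "Ck_on k S (\<lambda>x :: real ^ 'n::finite. a)"
proof (induction k arbitrary: a)
  case (Suc k)
  moreover have "partial i (\<lambda>x. a) = (\<lambda>x. 0)" for i :: 'n
    by (simp add: fun_eq_iff)
  ultimately show ?case
    by (simp add: Ck_on_Suc)
qed simp

lemma Ck_on_add:
  assumes "open S" "Ck_on k S f" "Ck_on k S h"
  shows "Ck_on k S (\<lambda>x. f x + h x)"
  using assms(2,3)
proof (induction k arbitrary: f h)
  case (Suc k)
  have "Ck_on k S (partial i (\<lambda>x. f x + h x))" for i
    by (rule Ck_on_cong[OF assms(1), of "\<lambda>x. partial i f x + partial i h x"])
       (use Suc in \<open>simp_all add: Ck_on_Suc partial_add\<close>)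
  with Suc.prems show ?case
    by (simp add: Ck_on_Suc)
qed (simp add: continuous_on_add)

lemma Ck_on_mult:
  assumes "open S" "Ck_on k S f" "Ck_on k S h"
  shows "Ck_on k S (\<lambda>x. f x * h x)"
  using assms(2,3)
proof (induction k arbitrary: f h)
  case (Suc k)
  have *: "Ck_on k S (\<lambda>x. partial i f x * h x + f x * partial i h x)" for i
    using Suc.prems Ck_on_SucD[OF Suc.prems(1)] Ck_on_SucD[OF Suc.prems(2)]
    by (intro Ck_on_add assms(1) Suc.IH) (simp_all add: Ck_on_Suc)
  then have "Ck_on k S (partial i (\<lambda>x. f x * h x))" for i
    using Suc.prems
    by (intro Ck_on_cong[OF assms(1) _ *]) (simp_all add: Ck_on_Suc partial_mult)
  with Suc.prems show ?case
    by (simp add: Ck_on_Suc)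
qed (simp add: continuous_on_mult)

text \<open>The derivative of 1/f contains 1/f itself and f', so the induction hypothesis and
  closure under products handle it at order k.\<close>

lemma Ck_on_inverse:
  assumes "open S" "Ck_on k S f" "\<And>x. x \<in> S \<Longrightarrow> f x \<noteq> 0"
  shows "Ck_on k S (\<lambda>x. inverse (f x))"
  using assms(2)
proof (induction k)
  case 0
  then show ?case
    using assms(3) by (simp add: continuous_on_inverse)
next
  case (Suc k)
  have "Ck_on k S (\<lambda>x. inverse (f x))"
    using Suc.IH Ck_on_SucD[OF Suc.prems] .
  \<comment> \<open>The sign is written as a constant factor, so that closure under products covers
    the whole expression.\<close>
  then have *: "Ck_on k S (\<lambda>x. (-1) * (inverse (f x) * partial i f x * inverse (f x)))" for i
    using Suc.prems by (intro Ck_on_mult Ck_on_const assms(1)) (simp_all add: Ck_on_Suc)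
  then have "Ck_on k S (partial i (\<lambda>x. inverse (f x)))" for i
    using Suc.prems assms(3)
    by (intro Ck_on_cong[OF assms(1) _ *]) (simp_all add: Ck_on_Suc partial_inverse)
  with Suc.prems assms(3) show ?case
    by (simp add: Ck_on_Suc)
qed

section \<open>Symmetry of mixed partial derivatives\<close>

text \<open>The mean value theorem is applied twice: along \<open>i\<close> to the difference of
  \<open>f\<close> on two parallel segments, then along \<open>j\<close> to
  \<open>partial i f\<close>. The left-hand side is symmetric in \<open>i\<close> and
  \<open>j\<close>, whereas the right-hand side fixes the order of differentiation.\<close>

lemma second_difference_eq_partial:
  assumes "Ck_on (Suc (Suc k)) S f" "cball x (2 * t) \<subseteq> S" "0 < t"
  shows "\<exists>\<xi> \<eta>. 0 < \<xi> \<and> \<xi> < t \<and> 0 < \<eta> \<and> \<eta> < t \<and>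
     f (x + t *\<^sub>R axis i 1 + t *\<^sub>R axis j 1) - f (x + t *\<^sub>R axis i 1) - f (x + t *\<^sub>R axis j 1) + f x
     = t * t * partial j (partial i f) (x + \<xi> *\<^sub>R axis i 1 + \<eta> *\<^sub>R axis j 1)"
proof -
  have inS: "x + a *\<^sub>R axis i 1 + b *\<^sub>R axis j 1 \<in> S" if "0 \<le> a" "a \<le> t" "0 \<le> b" "b \<le> t" for a b
  proof -
    have "norm (a *\<^sub>R axis i (1::real) + b *\<^sub>R axis j 1) \<le> 2 * t"
      using norm_triangle_ineq[of "a *\<^sub>R axis i (1::real)" "b *\<^sub>R axis j 1"] that by simp
    then have "x + (a *\<^sub>R axis i 1 + b *\<^sub>R axis j 1) \<in> cball x (2 * t)"
      unfolding mem_cball by (subst dist_commute) (simp add: dist_norm)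
    then show ?thesis
      using assms(2) by (auto simp: add.assoc)
  qed
  \<comment> \<open>Along a coordinate line the problem is one-dimensional, and linearity of the
    derivative turns it into multiplication by \<open>partial l u\<close>.\<close>
  have line: "((\<lambda>s. u (y + s *\<^sub>R axis l 1)) has_derivative (\<lambda>r. r * partial l u (y + s *\<^sub>R axis l 1))) (at s within T)"
    if "u differentiable (at (y + s *\<^sub>R axis l 1))" for u :: "real ^ 'a \<Rightarrow> real" and y s l T
  proof -
    let ?D = "frechet_derivative u (at (y + s *\<^sub>R axis l 1))"
    have "((\<lambda>s. u (y + s *\<^sub>R axis l 1)) has_derivative (\<lambda>r. ?D (r *\<^sub>R axis l 1))) (at s within T)"
      using that
      by (intro has_derivative_compose[of "\<lambda>s. y + s *\<^sub>R axis l 1" _ s T u])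
         (auto intro!: derivative_eq_intros simp: frechet_derivative_works)
    moreover have "linear ?D"
      using that linear_frechet_derivative by blast
    ultimately show ?thesis
      by (simp add: partial_def linear_cmul)
  qed
  let ?e = "axis i (1::real)" and ?d = "axis j (1::real)"
  have d1: "f differentiable (at y)" "partial i f differentiable (at y)" if "y \<in> S" for y
    using assms(1) that by (auto simp: Ck_on_Suc)
  have "\<exists>\<xi>\<in>{0<..<t}. (\<lambda>s. f ((x + t *\<^sub>R ?d) + s *\<^sub>R ?e) - f (x + s *\<^sub>R ?e)) t
      - (\<lambda>s. f ((x + t *\<^sub>R ?d) + s *\<^sub>R ?e) - f (x + s *\<^sub>R ?e)) 0
      = (\<lambda>\<xi> r. r * partial i f ((x + t *\<^sub>R ?d) + \<xi> *\<^sub>R ?e) - r * partial i f (x + \<xi> *\<^sub>R ?e)) \<xi> (t - 0)"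
    using assms(3)
  proof (intro mvt_simple has_derivative_diff line d1)
    fix s assume s: "0 \<le> s" "s \<le> t"
    show "x + t *\<^sub>R ?d + s *\<^sub>R ?e \<in> S" "x + s *\<^sub>R ?e \<in> S"
      using inS[OF s, of t] inS[OF s, of 0] assms(3) by (simp_all add: algebra_simps)
  qed auto
  then obtain \<xi> where \<xi>: "0 < \<xi>" "\<xi> < t" and
    1: "f (x + t *\<^sub>R ?e + t *\<^sub>R ?d) - f (x + t *\<^sub>R ?e) - f (x + t *\<^sub>R ?d) + f x
        = t * (partial i f ((x + \<xi> *\<^sub>R ?e) + t *\<^sub>R ?d) - partial i f (x + \<xi> *\<^sub>R ?e))"
    by (auto simp: algebra_simps)
  have "\<exists>\<eta>\<in>{0<..<t}. (\<lambda>s. partial i f ((x + \<xi> *\<^sub>R ?e) + s *\<^sub>R ?d)) t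
      - (\<lambda>s. partial i f ((x + \<xi> *\<^sub>R ?e) + s *\<^sub>R ?d)) 0
      = (\<lambda>\<eta> r. r * partial j (partial i f) ((x + \<xi> *\<^sub>R ?e) + \<eta> *\<^sub>R ?d)) \<eta> (t - 0)"
    using assms(3) \<xi> by (intro mvt_simple line d1 inS) auto
  then obtain \<eta> where "0 < \<eta>" "\<eta> < t"
    "partial i f ((x + \<xi> *\<^sub>R ?e) + t *\<^sub>R ?d) - partial i f (x + \<xi> *\<^sub>R ?e)
      = t * partial j (partial i f) ((x + \<xi> *\<^sub>R ?e) + \<eta> *\<^sub>R ?d)"
    by auto
  with 1 \<xi> show ?thesis
    by (metis mult.assoc)
qed

text \<open>Reading the second difference in both orders shows that the two mixed partials agree at
  two points of a small square; continuity at \<open>x\<close> then brings their values at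
  \<open>x\<close> arbitrarily close.\<close>

lemma partial_commute:
  assumes "open S" "x \<in> S" "Ck_on (Suc (Suc 0)) S f"
  shows "partial i (partial j f) x = partial j (partial i f) x"
proof -
  have "\<bar>partial i (partial j f) x - partial j (partial i f) x\<bar> \<le> 2 * e" if "0 < e" for e
  proof -
    have cont: "\<exists>d>0. \<forall>y\<in>S. dist y x < d \<longrightarrow> \<bar>partial k (partial l f) y - partial k (partial l f) x\<bar> < e" for k l
      using assms(3) assms(2) that unfolding Ck_on_Suc Ck_on.simps(1) continuous_on_iff dist_real_def
      by blast
    obtain d1 where d1: "d1 > 0"
      "\<And>y. y \<in> S \<Longrightarrow> dist y x < d1 \<Longrightarrow> \<bar>partial i (partial j f) y - partial i (partial j f) x\<bar> < e"
      using cont[of i j] by blast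
    obtain d2 where d2: "d2 > 0"
      "\<And>y. y \<in> S \<Longrightarrow> dist y x < d2 \<Longrightarrow> \<bar>partial j (partial i f) y - partial j (partial i f) x\<bar> < e"
      using cont[of j i] by blast
    obtain r where r: "r > 0" "cball x r \<subseteq> S"
      using assms(1,2) open_contains_cball by blast
    \<comment> \<open>Points of the square lie within \<open>2 * t\<close> of \<open>x\<close>;
      dividing by 3 keeps this strictly below both radii of continuity and inside the ball in
      \<open>S\<close>.\<close>
    define t where "t = min (min d1 d2) r / 3"
    have t: "0 < t" "2 * t < d1" "2 * t < d2" "2 * t \<le> r"
      using d1(1) d2(1) r(1) by (auto simp: t_def)
    have sub: "cball x (2 * t) \<subseteq> S"
      using r(2) subset_cball[OF t(4)] by blast
    have near: "dist (x + a *\<^sub>R axis k 1 + b *\<^sub>R axis l 1) x \<le> 2 * t"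
      if "0 < a" "a < t" "0 < b" "b < t" for a b k l
      using norm_triangle_ineq[of "a *\<^sub>R axis k (1::real)" "b *\<^sub>R axis l 1"] that
      by (simp add: dist_norm add.assoc)
    obtain a b where ab: "0 < a" "a < t" "0 < b" "b < t" and 1:
      "f (x + t *\<^sub>R axis i 1 + t *\<^sub>R axis j 1) - f (x + t *\<^sub>R axis i 1) - f (x + t *\<^sub>R axis j 1) + f x
       = t * t * partial j (partial i f) (x + a *\<^sub>R axis i 1 + b *\<^sub>R axis j 1)"
      using second_difference_eq_partial[OF assms(3) sub t(1)] by blast
    obtain a' b' where ab': "0 < a'" "a' < t" "0 < b'" "b' < t" and 2:
      "f (x + t *\<^sub>R axis j 1 + t *\<^sub>R axis i 1) - f (x + t *\<^sub>R axis j 1) - f (x + t *\<^sub>R axis i 1) + f x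
       = t * t * partial i (partial j f) (x + a' *\<^sub>R axis j 1 + b' *\<^sub>R axis i 1)"
      using second_difference_eq_partial[OF assms(3) sub t(1)] by blast
    let ?y = "x + a *\<^sub>R axis i 1 + b *\<^sub>R axis j 1" and ?z = "x + a' *\<^sub>R axis j 1 + b' *\<^sub>R axis i 1"
    have "t * t * partial j (partial i f) ?y = t * t * partial i (partial j f) ?z"
      using 1 2 by (simp add: algebra_simps)
    then have "partial j (partial i f) ?y = partial i (partial j f) ?z"
      using t(1) by simp
    moreover have "?y \<in> S" "?z \<in> S"
      using near[OF ab, of i j] near[OF ab', of j i] sub by (auto simp: dist_commute subset_iff)
    ultimately show ?thesis
      using d1(2)[of ?z] d2(2)[of ?y] near[OF ab, of i j] near[OF ab', of j i] t by fastforce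
  qed
  \<comment> \<open>With a quarter of the gap as \<open>e\<close>, the bound says that the gap is at
    most half of itself.\<close>
  from this[of "\<bar>partial i (partial j f) x - partial j (partial i f) x\<bar> / 4"] show ?thesis
    by fastforce
qed

section \<open>Calculus in a coordinate chart\<close>

locale coordinate_chart =
  fixes c :: "('a, 'n::finite) chart"
  assumes open_image: "open (snd c ` fst c)"
    and inj_on_domain: "inj_on (snd c) (fst c)"
begin

lemma chart_rep_apply [simp]: "p \<in> fst c \<Longrightarrow> chart_rep c f (snd c p) = f p"
  by (simp add: chart_rep_def inj_on_domain)

lemma pd_eq_partial: "pd c i f p = partial i (chart_rep c f) (snd c p)"
  by (simp add: pd_def partial_def)

lemma chart_rep_pd:
  "x \<in> snd c ` fst c \<Longrightarrow> chart_rep c (pd c i f) x = partial i (chart_rep c f) x"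
  by (auto simp: pd_eq_partial)

lemma smooth_in_chart_iff:
  "smooth_in_chart c f \<longleftrightarrow> (\<forall>k. Ck_on k (snd c ` fst c) (chart_rep c f))"
  by (simp add: smooth_in_chart_def smooth_on_def)

lemma smooth_cong:
  assumes "\<And>p. p \<in> fst c \<Longrightarrow> f p = h p" "smooth_in_chart c f"
  shows "smooth_in_chart c h"
proof -
  have "chart_rep c f x = chart_rep c h x" if "x \<in> snd c ` fst c" for x
    using that assms(1) by auto
  then show ?thesis
    using assms(2) Ck_on_cong[OF open_image] unfolding smooth_in_chart_iff by blast
qed

lemma smooth_const: "smooth_in_chart c (\<lambda>p. a)"
  by (simp add: smooth_in_chart_iff chart_rep_def Ck_on_const)

lemma smooth_add:
  "smooth_in_chart c f \<Longrightarrow> smooth_in_chart c h \<Longrightarrow> smooth_in_chart c (\<lambda>p. f p + h p)"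
  using Ck_on_add[OF open_image] by (simp add: smooth_in_chart_iff chart_rep_def)

lemma smooth_mult:
  "smooth_in_chart c f \<Longrightarrow> smooth_in_chart c h \<Longrightarrow> smooth_in_chart c (\<lambda>p. f p * h p)"
  using Ck_on_mult[OF open_image] by (simp add: smooth_in_chart_iff chart_rep_def)

lemma smooth_uminus: "smooth_in_chart c f \<Longrightarrow> smooth_in_chart c (\<lambda>p. - f p)"
  using smooth_mult[OF smooth_const[of "-1"], of f] by simp

lemma smooth_diff:
  "smooth_in_chart c f \<Longrightarrow> smooth_in_chart c h \<Longrightarrow> smooth_in_chart c (\<lambda>p. f p - h p)"
  using smooth_add[OF _ smooth_uminus, of f h] by simp

lemma smooth_inverse:
  assumes "smooth_in_chart c f" "\<And>p. p \<in> fst c \<Longrightarrow> f p \<noteq> 0"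
  shows "smooth_in_chart c (\<lambda>p. inverse (f p))"
proof -
  have "chart_rep c f x \<noteq> 0" if "x \<in> snd c ` fst c" for x
    using that assms(2) by auto
  then show ?thesis
    using Ck_on_inverse[OF open_image] assms(1) by (simp add: smooth_in_chart_iff chart_rep_def)
qed

lemma smooth_sum:
  "(\<And>i. i \<in> I \<Longrightarrow> smooth_in_chart c (f i)) \<Longrightarrow> smooth_in_chart c (\<lambda>p. \<Sum>i\<in>I. f i p)"
  by (induction I rule: infinite_finite_induct) (auto intro: smooth_const smooth_add)

lemma smooth_prod:
  "(\<And>i. i \<in> I \<Longrightarrow> smooth_in_chart c (f i)) \<Longrightarrow> smooth_in_chart c (\<lambda>p. \<Prod>i\<in>I. f i p)"
  by (induction I rule: infinite_finite_induct) (auto intro: smooth_const smooth_mult)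

lemma smooth_pd: "smooth_in_chart c f \<Longrightarrow> smooth_in_chart c (pd c i f)"
proof -
  assume f: "smooth_in_chart c f"
  have "Ck_on k (snd c ` fst c) (partial i (chart_rep c f))" for k
    using f by (meson Ck_on_Suc smooth_in_chart_iff)
  then show ?thesis
    unfolding smooth_in_chart_iff
    using Ck_on_cong[OF open_image, of "partial i (chart_rep c f)" "chart_rep c (pd c i f)"]
    by (simp add: chart_rep_pd)
qed

lemmas smooth_intros =
  smooth_const smooth_add smooth_mult smooth_uminus smooth_diff smooth_sum smooth_prod smooth_pd

lemma smooth_det:
  assumes "\<And>i j. smooth_in_chart c (f i j)"
  shows "smooth_in_chart c (\<lambda>p. det (\<chi> i j. f i j p :: real ^ 'm ^ 'm))"
  unfolding det_def by (simp, intro smooth_intros assms)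

lemma differentiable_chart_rep:
  "smooth_in_chart c f \<Longrightarrow> p \<in> fst c \<Longrightarrow> chart_rep c f differentiable (at (snd c p))"
  by (meson Ck_on_Suc smooth_in_chart_iff imageI)

lemma pd_cong:
  "p \<in> fst c \<Longrightarrow> (\<And>q. q \<in> fst c \<Longrightarrow> f q = h q) \<Longrightarrow> pd c i f p = pd c i h p"
  unfolding pd_eq_partial by (rule partial_cong[OF open_image]) auto

lemma pd_const [simp]: "pd c i (\<lambda>p. a) p = 0"
  by (simp add: pd_eq_partial chart_rep_def)

lemma pd_add:
  assumes "smooth_in_chart c f" "smooth_in_chart c h" "p \<in> fst c"
  shows "pd c i (\<lambda>q. f q + h q) p = pd c i f p + pd c i h p"
  using partial_add[OF differentiable_chart_rep differentiable_chart_rep, OF assms(1,3,2,3)]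
  by (simp add: pd_eq_partial chart_rep_def)

lemma pd_mult:
  assumes "smooth_in_chart c f" "smooth_in_chart c h" "p \<in> fst c"
  shows "pd c i (\<lambda>q. f q * h q) p = pd c i f p * h p + f p * pd c i h p"
  using partial_mult[OF differentiable_chart_rep differentiable_chart_rep, OF assms(1,3,2,3)] assms(3)
  by (simp add: pd_eq_partial chart_rep_def inj_on_domain)

lemma pd_cmult:
  "smooth_in_chart c f \<Longrightarrow> p \<in> fst c \<Longrightarrow> pd c i (\<lambda>q. a * f q) p = a * pd c i f p"
  by (simp add: pd_mult smooth_const)

lemma pd_uminus: "smooth_in_chart c f \<Longrightarrow> p \<in> fst c \<Longrightarrow> pd c i (\<lambda>q. - f q) p = - pd c i f p"
  using pd_cmult[of f p i "-1"] by simp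

lemma pd_diff:
  "smooth_in_chart c f \<Longrightarrow> smooth_in_chart c h \<Longrightarrow> p \<in> fst c \<Longrightarrow>
   pd c i (\<lambda>q. f q - h q) p = pd c i f p - pd c i h p"
  using pd_add[of f "\<lambda>q. - h q" p i] by (simp add: smooth_uminus pd_uminus)

lemma pd_sum:
  assumes "\<And>j. j \<in> I \<Longrightarrow> smooth_in_chart c (f j)" "p \<in> fst c"
  shows "pd c i (\<lambda>q. \<Sum>j\<in>I. f j q) p = (\<Sum>j\<in>I. pd c i (f j) p)"
  using assms(1)
  by (induction I rule: infinite_finite_induct) (simp_all add: pd_add smooth_sum assms(2))

lemmas pd_simps = pd_add pd_diff pd_uminus pd_cmult pd_mult pd_sum

text \<open>\<open>pd c j f\<close> is a function on the manifold, so its representation is first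
  replaced, on the image of the chart, by a partial derivative of
  \<open>chart_rep c f\<close>.\<close>

lemma pd_commute:
  assumes "smooth_in_chart c f" "p \<in> fst c"
  shows "pd c i (pd c j f) p = pd c j (pd c i f) p"
proof -
  have "pd c i (pd c j f) p = partial i (partial j (chart_rep c f)) (snd c p)" for i j
    unfolding pd_eq_partial[of i]
    by (rule partial_cong[OF open_image]) (use assms(2) in \<open>auto simp: chart_rep_pd[symmetric]\<close>)
  then show ?thesis
    using partial_commute[OF open_image, of "snd c p" "chart_rep c f"] assms
    by (simp add: smooth_in_chart_iff)
qed

end

lemma is_chart_imp_coordinate_chart:
  assumes "is_chart X c"
  shows "coordinate_chart c"
proof
  have "topspace (subtopology X (fst c)) = fst c"
    using assms openin_subset by (fastforce simp: is_chart_def)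
  then show "inj_on (snd c) (fst c)"
    using assms by (metis is_chart_def homeomorphic_imp_injective_map)
qed (use assms in \<open>simp add: is_chart_def\<close>)

section \<open>Finite sums over indices and the Kronecker delta\<close>

lemma sum_swap2:
  "(\<Sum>i\<in>I. \<Sum>j\<in>J. \<Sum>k\<in>K. \<Sum>l\<in>L. f i j k l) = (\<Sum>k\<in>K. \<Sum>l\<in>L. \<Sum>i\<in>I. \<Sum>j\<in>J. f i j k l)"
proof -
  have "(\<Sum>u\<in>I \<times> J. \<Sum>v\<in>K \<times> L. f (fst u) (snd u) (fst v) (snd v))
      = (\<Sum>v\<in>K \<times> L. \<Sum>u\<in>I \<times> J. f (fst u) (snd u) (fst v) (snd v))"
    by (rule sum.swap)
  then show ?thesis
    by (simp only: sum.cartesian_product' fst_conv snd_conv)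
qed

lemma kdelta_sym: "kdelta i j = kdelta j i"
  by (simp add: kdelta_def)

lemma sum_kdelta [simp]:
  "(\<Sum>s\<in>UNIV. kdelta i s * f s) = f (i :: 'n::finite)" "(\<Sum>s\<in>UNIV. kdelta s i * f s) = f i"
  "(\<Sum>s\<in>UNIV. f s * kdelta i s) = f i" "(\<Sum>s\<in>UNIV. f s * kdelta s i) = f i"
proof -
  have "kdelta i s * f s = (if s = i then f s else 0)" for s
    by (simp add: kdelta_def)
  then show "(\<Sum>s\<in>UNIV. kdelta i s * f s) = f i"
    by simp
  then show "(\<Sum>s\<in>UNIV. kdelta s i * f s) = f i" "(\<Sum>s\<in>UNIV. f s * kdelta i s) = f i"
    "(\<Sum>s\<in>UNIV. f s * kdelta s i) = f i"
    by (simp_all add: kdelta_sym[of _ i] mult.commute)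
qed

section \<open>The Levi-Civita connection in a chart\<close>

locale riemannian_chart = coordinate_chart c for c :: "('a, 'n::finite) chart" +
  fixes g :: "('a, 'n) tensor2"
  assumes smooth_g: "smooth_in_chart c (g c i j)"
    and g_sym: "p \<in> fst c \<Longrightarrow> g c i j p = g c j i p"
    and g_posdef: "\<And>v :: real ^ 'n. p \<in> fst c \<Longrightarrow> v \<noteq> 0 \<Longrightarrow>
      0 < (\<Sum>i\<in>UNIV. \<Sum>j\<in>UNIV. g c i j p * v $ i * v $ j)"
begin

text \<open>A vector \<open>v\<close> in the kernel would satisfy g(v,v) = 0, against positive
  definiteness.\<close>

lemma det_g_nonzero:
  assumes "p \<in> fst c"
  shows "det (\<chi> a b. g c a b p) \<noteq> 0"
proof -
  have "v = 0" if "(\<chi> a b. g c a b p) *v v = 0" for v :: "real ^ 'n"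
  proof (rule ccontr)
    assume "v \<noteq> 0"
    have "0 = (\<Sum>i\<in>UNIV. ((\<chi> a b. g c a b p) *v v) $ i * v $ i)"
      by (simp add: that)
    also have "\<dots> = (\<Sum>i\<in>UNIV. \<Sum>j\<in>UNIV. g c i j p * v $ i * v $ j)"
      by (simp add: matrix_vector_mult_def sum_distrib_left mult_ac)
    finally show False
      using g_posdef[OF assms \<open>v \<noteq> 0\<close>] by simp
  qed
  then show ?thesis
    by (simp add: invertible_det_nz[symmetric] invertible_left_inverse matrix_left_invertible_ker)
qed

lemma invertible_g: "p \<in> fst c \<Longrightarrow> invertible (\<chi> a b. g c a b p)"
  by (simp add: invertible_det_nz det_g_nonzero)

lemma g_ginv:
  assumes "p \<in> fst c"
  shows "(\<Sum>s\<in>UNIV. g c i s p * ginv g c s j p) = kdelta i j"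
    and "(\<Sum>s\<in>UNIV. ginv g c i s p * g c s j p) = kdelta i j"
proof -
  let ?G = "\<chi> a b. g c a b p"
  have "?G ** matrix_inv ?G = mat 1 \<and> matrix_inv ?G ** ?G = mat 1"
    using invertible_g[OF assms] unfolding invertible_def matrix_inv_def by (rule someI_ex)
  then have "(?G ** matrix_inv ?G) $ i $ j = kdelta i j" "(matrix_inv ?G ** ?G) $ i $ j = kdelta i j"
    by (simp_all add: mat_def kdelta_def)
  then show "(\<Sum>s\<in>UNIV. g c i s p * ginv g c s j p) = kdelta i j"
    "(\<Sum>s\<in>UNIV. ginv g c i s p * g c s j p) = kdelta i j"
    by (simp_all add: matrix_matrix_mult_def ginv_def)
qed

lemma ginv_sym:
  assumes "p \<in> fst c"
  shows "ginv g c i j p = ginv g c j i p"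
proof -
  have "ginv g c i j p = (\<Sum>a\<in>UNIV. ginv g c i a p * (\<Sum>b\<in>UNIV. g c a b p * ginv g c b j p))"
    by (simp add: g_ginv assms)
  also have "\<dots> = (\<Sum>a\<in>UNIV. ginv g c i a p * (\<Sum>b\<in>UNIV. ginv g c j b p * g c b a p))"
    by (simp add: g_ginv assms kdelta_sym)
  also have "\<dots> = (\<Sum>b\<in>UNIV. ginv g c j b p * (\<Sum>a\<in>UNIV. g c b a p * ginv g c i a p))"
    unfolding sum_distrib_left by (subst sum.swap) (simp add: mult_ac)
  also have "\<dots> = (\<Sum>b\<in>UNIV. ginv g c j b p * (\<Sum>a\<in>UNIV. ginv g c i a p * g c a b p))"
    by (simp add: g_sym[OF assms] mult.commute)
  also have "\<dots> = ginv g c j i p"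
    by (simp add: g_ginv assms)
  finally show ?thesis .
qed

text \<open>By Cramer's rule the entries of the inverse are quotients of determinants in the
  components of \<open>g\<close>, with nonvanishing denominator.\<close>

lemma smooth_ginv: "smooth_in_chart c (ginv g c i j)"
proof (rule smooth_cong)
  let ?G = "\<lambda>p. \<chi> a b. g c a b p"
  let ?N = "\<lambda>p. det (\<chi> a b. if b = i then kdelta a j else g c a b p)"
  show "?N p * inverse (det (?G p)) = ginv g c i j p" if p: "p \<in> fst c" for p
  proof -
    \<comment> \<open>Column \<open>j\<close> of the inverse solves the linear system whose
      right-hand side is the unit vector \<open>j\<close>.\<close>
    have "?G p *v (\<chi> s. ginv g c s j p) = (\<chi> a. kdelta a j)"
      by (simp add: matrix_vector_mult_def g_ginv p)
    from cramer[OF det_g_nonzero[OF p], THEN iffD1, OF this] show ?thesis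
      by (simp add: vec_eq_iff divide_inverse cong: if_cong)
  qed
  have "smooth_in_chart c (\<lambda>p. if b = i then kdelta a j else g c a b p)" for a b
    by (cases "b = i") (simp_all add: smooth_const smooth_g)
  then show "smooth_in_chart c (\<lambda>p. ?N p * inverse (det (?G p)))"
    by (intro smooth_mult smooth_inverse smooth_det smooth_g det_g_nonzero)
qed

abbreviation "\<Gamma> \<equiv> christoffel g c"

lemma smooth_christoffel: "smooth_in_chart c (\<Gamma> m i j)"
  unfolding christoffel_def[abs_def]
  by (intro smooth_intros smooth_ginv smooth_g)

lemma pd_g_sym: "p \<in> fst c \<Longrightarrow> pd c k (g c i j) p = pd c k (g c j i) p"
  by (intro pd_cong g_sym)

lemma christoffel_sym: "p \<in> fst c \<Longrightarrow> \<Gamma> m i j p = \<Gamma> m j i p"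
  unfolding christoffel_def by (simp add: pd_g_sym[of p _ i j] algebra_simps)

text \<open>Lowering the upper index cancels \<open>ginv\<close> and leaves the Christoffel symbols
  of the first kind.\<close>

lemma sum_g_christoffel:
  assumes "p \<in> fst c"
  shows "(\<Sum>m\<in>UNIV. g c a m p * \<Gamma> m i j p) =
    1/2 * (pd c i (g c j a) p + pd c j (g c i a) p - pd c a (g c i j) p)"
proof -
  define Q where "Q s = pd c i (g c j s) p + pd c j (g c i s) p - pd c s (g c i j) p" for s
  have "(\<Sum>m\<in>UNIV. g c a m p * \<Gamma> m i j p)
      = (\<Sum>m\<in>UNIV. \<Sum>s\<in>UNIV. g c a m p * ginv g c m s p * (1/2 * Q s))"
    by (simp add: christoffel_def Q_def[symmetric] sum_distrib_left mult.assoc)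
  also have "\<dots> = (\<Sum>s\<in>UNIV. (\<Sum>m\<in>UNIV. g c a m p * ginv g c m s p) * (1/2 * Q s))"
    by (subst sum.swap) (simp only: sum_distrib_right)
  also have "\<dots> = 1/2 * Q a"
    by (simp only: g_ginv[OF assms] sum_kdelta)
  finally show ?thesis
    by (simp add: Q_def)
qed

text \<open>Metric compatibility: the two symbols of the first kind add up to the partial derivative
  of the metric.\<close>

lemma nabla2_g:
  assumes "p \<in> fst c"
  shows "nabla2 g g c k a b p = 0"
proof -
  have "(\<Sum>s\<in>UNIV. \<Gamma> s k a p * g c s b p) = 1/2 * (pd c k (g c a b) p + pd c a (g c k b) p - pd c b (g c k a) p)"
    using sum_g_christoffel[OF assms, of b k a] by (simp add: g_sym[OF assms, of _ b] mult.commute)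
  moreover have "(\<Sum>s\<in>UNIV. \<Gamma> s k b p * g c a s p) = 1/2 * (pd c k (g c b a) p + pd c b (g c k a) p - pd c a (g c k b) p)"
    using sum_g_christoffel[OF assms, of a k b] by (simp add: mult.commute)
  ultimately show ?thesis
    by (simp add: nabla2_def pd_g_sym[OF assms, of k b a])
qed

text \<open>Two of the three derivative terms cancel because \<open>ginv\<close> is symmetric. What
  remains is the gradient of half the logarithm of det g, in a form free of determinants.\<close>

lemma christoffel_trace:
  assumes "p \<in> fst c"
  shows "(\<Sum>m\<in>UNIV. \<Gamma> m k m p) = 1/2 * (\<Sum>m\<in>UNIV. \<Sum>s\<in>UNIV. ginv g c m s p * pd c k (g c m s) p)"
proof -
  have "(\<Sum>m\<in>UNIV. \<Sum>s\<in>UNIV. ginv g c m s p * pd c m (g c k s) p)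
      = (\<Sum>m\<in>UNIV. \<Sum>s\<in>UNIV. ginv g c m s p * pd c s (g c k m) p)"
    by (subst sum.swap) (simp add: ginv_sym[OF assms])
  then show ?thesis
    unfolding christoffel_def sum_distrib_left[symmetric]
    by (simp add: distrib_left right_diff_distrib sum.distrib sum_subtractf)
qed

text \<open>Differentiate the identity that \<open>g\<close> times \<open>ginv\<close> is constant,
  then multiply by \<open>ginv\<close> from the left.\<close>

lemma pd_ginv:
  assumes p: "p \<in> fst c"
  shows "pd c l (ginv g c m s) p =
    - (\<Sum>a\<in>UNIV. \<Sum>b\<in>UNIV. ginv g c m a p * pd c l (g c a b) p * ginv g c b s p)"
proof -
  have *: "(\<Sum>b\<in>UNIV. g c a b p * pd c l (ginv g c b s) p)
      = - (\<Sum>b\<in>UNIV. pd c l (g c a b) p * ginv g c b s p)" for a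
  proof -
    have "pd c l (\<lambda>q. \<Sum>b\<in>UNIV. g c a b q * ginv g c b s q) p = pd c l (\<lambda>q. kdelta a s) p"
      by (rule pd_cong[OF p]) (simp add: g_ginv)
    then show ?thesis
      by (simp add: pd_simps smooth_intros smooth_g smooth_ginv p sum.distrib)
  qed
  have "pd c l (ginv g c m s) p
      = (\<Sum>b\<in>UNIV. (\<Sum>a\<in>UNIV. ginv g c m a p * g c a b p) * pd c l (ginv g c b s) p)"
    by (simp add: g_ginv p)
  also have "\<dots> = (\<Sum>a\<in>UNIV. ginv g c m a p * (\<Sum>b\<in>UNIV. g c a b p * pd c l (ginv g c b s) p))"
    unfolding sum_distrib_left sum_distrib_right by (subst sum.swap) (simp add: mult_ac)
  finally show ?thesis
    by (simp add: * sum_negf sum_distrib_left mult.assoc)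
qed

text \<open>The trace is locally a gradient, so its derivative is a Hessian. Concretely, second
  derivatives of \<open>g\<close> commute, and the term quadratic in first derivatives is symmetric
  under exchanging the index pairs (m,s) and (a,b).\<close>

lemma pd_christoffel_trace_sym:
  assumes p: "p \<in> fst c"
  shows "(\<Sum>m\<in>UNIV. pd c l (\<Gamma> m k m) p) = (\<Sum>m\<in>UNIV. pd c k (\<Gamma> m l m) p)"
proof -
  let ?q = "\<lambda>l k m s a b. ginv g c m a p * pd c l (g c a b) p * ginv g c b s p * pd c k (g c m s) p"
  have *: "(\<Sum>m\<in>UNIV. pd c l (\<Gamma> m k m) p) =
      1/2 * ((\<Sum>m\<in>UNIV. \<Sum>s\<in>UNIV. ginv g c m s p * pd c l (pd c k (g c m s)) p)
        - (\<Sum>m\<in>UNIV. \<Sum>s\<in>UNIV. \<Sum>a\<in>UNIV. \<Sum>b\<in>UNIV. ?q l k m s a b))" for l k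
  proof -
    have "(\<Sum>m\<in>UNIV. pd c l (\<Gamma> m k m) p) = pd c l (\<lambda>q. \<Sum>m\<in>UNIV. \<Gamma> m k m q) p"
      by (simp add: pd_sum smooth_christoffel p)
    also have "\<dots> = pd c l (\<lambda>q. 1/2 * (\<Sum>m\<in>UNIV. \<Sum>s\<in>UNIV. ginv g c m s q * pd c k (g c m s) q)) p"
      by (rule pd_cong[OF p]) (rule christoffel_trace)
    also have "\<dots> = 1/2 * (\<Sum>m\<in>UNIV. \<Sum>s\<in>UNIV.
        pd c l (ginv g c m s) p * pd c k (g c m s) p + ginv g c m s p * pd c l (pd c k (g c m s)) p)"
      by (simp only: pd_simps smooth_intros smooth_g smooth_ginv p)
    finally show ?thesis
      by (simp add: pd_ginv p sum.distrib sum_subtractf sum_negf sum_distrib_right)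
  qed
  have "(\<Sum>m\<in>UNIV. \<Sum>s\<in>UNIV. \<Sum>a\<in>UNIV. \<Sum>b\<in>UNIV. ?q l k m s a b)
      = (\<Sum>a\<in>UNIV. \<Sum>b\<in>UNIV. \<Sum>m\<in>UNIV. \<Sum>s\<in>UNIV. ?q l k m s a b)"
    by (rule sum_swap2)
  also have "\<dots> = (\<Sum>a\<in>UNIV. \<Sum>b\<in>UNIV. \<Sum>m\<in>UNIV. \<Sum>s\<in>UNIV. ?q k l a b m s)"
    by (simp add: ginv_sym[OF p] mult_ac)
  finally show ?thesis
    by (simp add: * pd_commute[OF smooth_g p, of l k])
qed

end

section \<open>Curvature identities in a chart\<close>

lemma matrix_diff_ldistrib: "A ** (B - C) = A ** B - A ** (C :: real ^ 'n ^ 'm)"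
  by (simp add: matrix_matrix_mult_def vec_eq_iff right_diff_distrib sum_subtractf)

lemma matrix_diff_rdistrib: "(A - B) ** C = A ** C - B ** (C :: real ^ 'n ^ 'm)"
  by (simp add: matrix_matrix_mult_def vec_eq_iff left_diff_distrib sum_subtractf)

lemma matrix_add_rdistrib: "(A + B) ** C = A ** C + B ** (C :: real ^ 'n ^ 'm)"
  by (simp add: matrix_matrix_mult_def vec_eq_iff distrib_right sum.distrib)

lemma riemann_antisym: "riemann g c j k l m p = - riemann g c k j l m p"
  by (simp add: riemann_def sum_subtractf)

context riemannian_chart
begin

lemma pd_christoffel_sym: "p \<in> fst c \<Longrightarrow> pd c k (\<Gamma> m i j) p = pd c k (\<Gamma> m j i) p"
  by (intro pd_cong christoffel_sym)

lemma smooth_riemann: "smooth_in_chart c (riemann g c j k l m)"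
  unfolding riemann_def[abs_def] by (intro smooth_intros smooth_christoffel)

lemma smooth_ricci: "smooth_in_chart c (ricci g c k l)"
  unfolding ricci_def[abs_def] by (intro smooth_intros smooth_riemann)

lemma smooth_ricci_mixed: "smooth_in_chart c (ricci_mixed g c j m)"
  unfolding ricci_mixed_def[abs_def] by (intro smooth_intros smooth_ginv smooth_ricci)

lemma smooth_scalar_curv: "smooth_in_chart c (scalar_curv g c)"
  unfolding scalar_curv_def[abs_def] by (intro smooth_intros smooth_ginv smooth_ricci)

text \<open>This is torsion-freeness: once the lower indices of the Christoffel symbols are sorted,
  all terms cancel in pairs.\<close>

lemma first_bianchi:
  assumes "p \<in> fst c"
  shows "riemann g c j k l m p + riemann g c k l j m p + riemann g c l j k m p = 0"
  by (simp add: riemann_def sum_subtractf pd_christoffel_sym[OF assms, of _ _ l]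
      pd_christoffel_sym[OF assms, of _ _ k j] christoffel_sym[OF assms, of _ k j]
      christoffel_sym[OF assms, of _ l j] christoffel_sym[OF assms, of _ l k])

text \<open>The trace of a commutator vanishes, and the derivative terms cancel because the
  Christoffel trace has a symmetric derivative.\<close>

lemma riemann_trace:
  assumes "p \<in> fst c"
  shows "(\<Sum>m\<in>UNIV. riemann g c j k m m p) = 0"
proof -
  have "(\<Sum>m\<in>UNIV. \<Sum>s\<in>UNIV. \<Gamma> s k m p * \<Gamma> m j s p) = (\<Sum>m\<in>UNIV. \<Sum>s\<in>UNIV. \<Gamma> s j m p * \<Gamma> m k s p)"
    by (subst sum.swap) (simp add: mult.commute)
  then show ?thesis
    by (simp add: riemann_def sum.distrib sum_subtractf pd_christoffel_trace_sym[OF assms, of k j])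
qed

text \<open>Contract the first Bianchi identity; of its three terms one is the vanishing trace and
  the other two are Ricci tensors of opposite sign.\<close>

lemma ricci_sym:
  assumes "p \<in> fst c"
  shows "ricci g c k l p = ricci g c l k p"
proof -
  have "(\<Sum>m\<in>UNIV. riemann g c m k l m p) + (\<Sum>m\<in>UNIV. riemann g c k l m m p)
      + (\<Sum>m\<in>UNIV. riemann g c l m k m p) = 0"
    by (simp add: sum.distrib[symmetric] first_bianchi[OF assms])
  moreover have "(\<Sum>m\<in>UNIV. riemann g c l m k m p) = ricci g c l k p"
    by (subst riemann_antisym) (simp add: ricci_def sum_negf)
  ultimately show ?thesis
    using riemann_trace[OF assms, of k l] by (simp add: ricci_def)
qed

text \<open>With the connection matrices \<open>M\<^sub>i\<close> and the curvature matrices \<open>F\<^sub>j\<^sub>k\<close>, this is the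
  structure equation \<open>dF = [M, F]\<close>; the Christoffel terms that act on the form indices cancel
  by symmetry.\<close>

lemma second_bianchi:
  assumes p: "p \<in> fst c"
  shows "nabla4 g (riemann g) c i j k l m p + nabla4 g (riemann g) c j k i l m p
    + nabla4 g (riemann g) c k i j l m p = 0"
proof -
  \<comment> \<open>Rows carry the lower index and columns the upper one, so that contraction over
    \<open>s\<close> becomes a matrix product.\<close>
  define M where "M i = (\<chi> l s. \<Gamma> s i l p)" for i
  define M' where "M' i j = (\<chi> l s. pd c i (\<Gamma> s j l) p)" for i j
  define M'' where "M'' i k j = (\<chi> l s. pd c i (pd c k (\<Gamma> s j l)) p)" for i j k
  define F where "F j k = (\<chi> l m. riemann g c j k l m p)" for j k
  define F' where "F' i j k = (\<chi> l m. pd c i (riemann g c j k l m) p)" for i j k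
  define Q where "Q i j k = F' i j k - M i ** F j k + F j k ** M i" for i j k
  have F: "F j k = M' k j - M' j k + M j ** M k - M k ** M j" for j k
    by (simp add: F_def M_def M'_def riemann_def vec_eq_iff matrix_matrix_mult_def sum_subtractf)
  have F': "F' i j k = M'' i k j - M'' i j k + (M' i j ** M k + M j ** M' i k)
      - (M' i k ** M j + M k ** M' i j)" for i j k
    by (simp add: F'_def M_def M'_def M''_def riemann_def[abs_def] vec_eq_iff matrix_matrix_mult_def
        pd_simps smooth_intros smooth_christoffel p sum_subtractf sum.distrib)
  have M'': "M'' i k j = M'' k i j" for i j k
    by (simp add: M''_def vec_eq_iff pd_commute[OF smooth_christoffel p, of i k])
  have "Q i j k + Q j k i + Q k i j = 0"
    unfolding Q_def F F' M''[of j i] M''[of k i] M''[of k j]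
    by (simp add: matrix_add_ldistrib matrix_add_rdistrib matrix_diff_ldistrib
        matrix_diff_rdistrib matrix_mul_assoc)
  then have "(Q i j k + Q j k i + Q k i j) $ l $ m = 0"
    by simp
  moreover have "nabla4 g (riemann g) c i j k l m p = Q i j k $ l $ m
      - (\<Sum>s\<in>UNIV. \<Gamma> s i j p * riemann g c s k l m p)
      + (\<Sum>s\<in>UNIV. \<Gamma> s i k p * riemann g c s j l m p)" for i j k
    by (simp add: nabla4_def Q_def F_def F'_def M_def matrix_matrix_mult_def
        riemann_antisym[of g c j] sum_negf mult.commute)
  ultimately show ?thesis
    by (simp add: christoffel_sym[OF p, of _ j i] christoffel_sym[OF p, of _ k i]
        christoffel_sym[OF p, of _ k j])
qed

section \<open>The contracted second Bianchi identity\<close>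

lemma nabla4_riemann_antisym:
  assumes "p \<in> fst c"
  shows "nabla4 g (riemann g) c i j k l m p = - nabla4 g (riemann g) c i k j l m p"
proof -
  have "pd c i (riemann g c j k l m) p = - pd c i (riemann g c k j l m) p"
    using pd_uminus[OF smooth_riemann assms, of i k j l m] by (simp add: riemann_antisym[of g c j k, symmetric])
  then show ?thesis
    by (simp add: nabla4_def riemann_antisym[of g c _ k] riemann_antisym[of g c j] sum_negf)
qed

text \<open>Contraction commutes with the covariant derivative: the Christoffel terms of the
  contracted pair of indices cancel. The sign is that of the Ricci convention.\<close>

lemma nabla4_riemann_trace:
  assumes "p \<in> fst c"
  shows "(\<Sum>m\<in>UNIV. nabla4 g (riemann g) c i m k l m p) = - nabla2 g (ricci g) c i k l p"
proof -
  have "(\<Sum>m\<in>UNIV. \<Sum>s\<in>UNIV. \<Gamma> s i m p * riemann g c s k l m p)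
      = (\<Sum>m\<in>UNIV. \<Sum>s\<in>UNIV. \<Gamma> m i s p * riemann g c m k l s p)"
    by (rule sum.swap)
  moreover have "(\<Sum>m\<in>UNIV. \<Sum>s\<in>UNIV. \<Gamma> s i k p * riemann g c m s l m p)
      = - (\<Sum>s\<in>UNIV. \<Gamma> s i k p * ricci g c s l p)"
    "(\<Sum>m\<in>UNIV. \<Sum>s\<in>UNIV. \<Gamma> s i l p * riemann g c m k s m p)
      = - (\<Sum>s\<in>UNIV. \<Gamma> s i l p * ricci g c k s p)"
    by (subst sum.swap, simp add: ricci_def sum_distrib_left sum_negf)+
  moreover have "(\<Sum>m\<in>UNIV. pd c i (riemann g c m k l m) p) = - pd c i (ricci g c k l) p"
    by (simp add: ricci_def[abs_def] pd_simps smooth_intros smooth_riemann assms)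
  ultimately show ?thesis
    by (simp add: nabla4_def nabla2_def sum.distrib sum_subtractf)
qed

text \<open>In the second Bianchi identity, contract the upper index with the differentiation index
  of the first term. Antisymmetry moves \<open>m\<close> to the first slot in the other two terms,
  which then become derivatives of the Ricci tensor.\<close>

lemma divergence_riemann:
  assumes "p \<in> fst c"
  shows "(\<Sum>m\<in>UNIV. nabla4 g (riemann g) c m j k l m p)
    = nabla2 g (ricci g) c k j l p - nabla2 g (ricci g) c j k l p"
proof -
  have "(\<Sum>m\<in>UNIV. nabla4 g (riemann g) c m j k l m p
      - nabla4 g (riemann g) c j m k l m p + nabla4 g (riemann g) c k m j l m p) = 0"
    using second_bianchi[OF assms] by (simp add: nabla4_riemann_antisym[OF assms, of j _ k])
  then show ?thesis
    by (simp add: sum.distrib sum_subtractf nabla4_riemann_trace[OF assms])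
qed

section \<open>Covariant derivatives of products and contractions\<close>

lemma nabla2_add:
  assumes "\<And>k l. smooth_in_chart c (S c k l)" "\<And>k l. smooth_in_chart c (T c k l)" "p \<in> fst c"
  shows "nabla2 g (\<lambda>c k l q. S c k l q + T c k l q) c i k l p
    = nabla2 g S c i k l p + nabla2 g T c i k l p"
  by (simp add: nabla2_def pd_add assms sum.distrib algebra_simps)

lemma nabla2_scalar_mult:
  assumes "smooth_in_chart c (f c)" "\<And>k l. smooth_in_chart c (T c k l)" "p \<in> fst c"
  shows "nabla2 g (\<lambda>c k l q. f c q * T c k l q) c i k l p
    = pd c i (f c) p * T c k l p + f c p * nabla2 g T c i k l p"
  by (simp add: nabla2_def pd_mult assms sum_distrib_left algebra_simps)

lemma nabla2_antisym:
  assumes "p \<in> fst c"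
  shows "nabla2 g T c k j l p - nabla2 g T c j k l p = pd c k (T c j l) p - pd c j (T c k l) p
    - (\<Sum>s\<in>UNIV. \<Gamma> s k l p * T c j s p) + (\<Sum>s\<in>UNIV. \<Gamma> s j l p * T c k s p)"
  by (simp add: nabla2_def christoffel_sym[OF assms, of _ k j])

text \<open>All three curvature tensors are the Riemann tensor plus a constant times an expression
  antisymmetrized in \<open>j\<close> and \<open>k\<close>; this isolates the divergence of a single
  \<open>L\<close>.\<close>

lemma nabla4_add_antisymmetrized:
  assumes "\<And>j k l m. smooth_in_chart c (K c j k l m)" "\<And>j k l m. smooth_in_chart c (L c j k l m)"
    "p \<in> fst c"
  shows "nabla4 g (\<lambda>c j k l m q. K c j k l m q + a * (L c j k l m q - L c k j l m q)) c i j k l m p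
    = nabla4 g K c i j k l m p + a * (nabla4 g L c i j k l m p - nabla4 g L c i k j l m p)"
  by (simp add: nabla4_def pd_simps smooth_intros assms sum.distrib sum_subtractf
      sum_distrib_left algebra_simps)

lemma nabla4_add:
  assumes "\<And>j k l m. smooth_in_chart c (K c j k l m)" "\<And>j k l m. smooth_in_chart c (L c j k l m)"
    "p \<in> fst c"
  shows "nabla4 g (\<lambda>c j k l m q. K c j k l m q + L c j k l m q) c i j k l m p
    = nabla4 g K c i j k l m p + nabla4 g L c i j k l m p"
  by (simp add: nabla4_def pd_simps smooth_intros assms sum.distrib algebra_simps)

text \<open>The Kronecker delta is parallel, since its two Christoffel terms cancel; contracting it
  renames the differentiation index to \<open>j\<close>.\<close>

lemma divergence_kdelta_mult:
  assumes "\<And>k l. smooth_in_chart c (T c k l)" "p \<in> fst c"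
  shows "(\<Sum>m\<in>UNIV. nabla4 g (\<lambda>c j k l m q. kdelta j m * T c k l q) c m j k l m p)
    = nabla2 g T c j k l p"
proof -
  have "nabla4 g (\<lambda>c j k l m q. kdelta j m * T c k l q) c i j k l m p
      = kdelta j m * nabla2 g T c i k l p" for i m
  proof -
    have "(\<Sum>s\<in>UNIV. \<Gamma> s i j p * (kdelta s m * T c k l p)) = \<Gamma> m i j p * T c k l p"
      "(\<Sum>s\<in>UNIV. \<Gamma> m i s p * (kdelta j s * T c k l p)) = \<Gamma> m i j p * T c k l p"
      by (simp_all add: mult.left_commute[of _ "kdelta _ _"])
    then show ?thesis
      by (simp add: nabla4_def nabla2_def pd_cmult assms sum_distrib_left algebra_simps)
  qed
  then show ?thesis
    by simp
qed

text \<open>The components \<open>\<nabla>\<^sub>i T\<^sub>j\<^sup>m\<close>; the last index of \<open>T\<close> is the upper one.\<close>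

definition nabla_mixed where
  "nabla_mixed T i j m p = pd c i (T c j m) p
     - (\<Sum>s\<in>UNIV. \<Gamma> s i j p * T c s m p) + (\<Sum>s\<in>UNIV. \<Gamma> m i s p * T c j s p)"

lemma divergence_mult_g:
  assumes "\<And>j m. smooth_in_chart c (T c j m)" "p \<in> fst c"
  shows "(\<Sum>m\<in>UNIV. nabla4 g (\<lambda>c j k l m q. T c j m q * g c k l q) c m j k l m p)
    = (\<Sum>m\<in>UNIV. nabla_mixed T m j m p) * g c k l p"
proof -
  have "nabla4 g (\<lambda>c j k l m q. T c j m q * g c k l q) c i j k l m p
      = nabla_mixed T i j m p * g c k l p + T c j m p * nabla2 g g c i k l p" for i m
    by (simp add: nabla4_def nabla_mixed_def nabla2_def pd_mult assms smooth_g sum_distrib_left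
        sum_distrib_right algebra_simps)
  then show ?thesis
    by (simp add: nabla2_g assms(2) sum_distrib_right)
qed

text \<open>The Christoffel terms of the lower and the upper index cancel after contraction.\<close>

lemma pd_trace:
  assumes "\<And>j m. smooth_in_chart c (T c j m)" "p \<in> fst c"
  shows "pd c i (\<lambda>q. \<Sum>m\<in>UNIV. T c m m q) p = (\<Sum>m\<in>UNIV. nabla_mixed T i m m p)"
proof -
  have "(\<Sum>m\<in>UNIV. \<Sum>s\<in>UNIV. \<Gamma> s i m p * T c s m p) = (\<Sum>m\<in>UNIV. \<Sum>s\<in>UNIV. \<Gamma> m i s p * T c m s p)"
    by (rule sum.swap)
  then show ?thesis
    by (simp add: nabla_mixed_def pd_sum assms sum.distrib sum_subtractf)
qed

lemma nabla2_lower: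
  assumes "\<And>j m. smooth_in_chart c (T c j m)" "p \<in> fst c"
  shows "nabla2 g (\<lambda>c j l q. \<Sum>m\<in>UNIV. g c l m q * T c j m q) c k j l p
    = (\<Sum>m\<in>UNIV. g c l m p * nabla_mixed T k j m p)"
proof -
  \<comment> \<open>Metric compatibility solved for the partial derivative. The first sum cancels
    the correction for the lowered index \<open>l\<close>; the second becomes the correction for the
    upper index \<open>m\<close>.\<close>
  have pd_g: "pd c k (g c l m) p
      = (\<Sum>s\<in>UNIV. \<Gamma> s k l p * g c s m p) + (\<Sum>s\<in>UNIV. \<Gamma> s k m p * g c l s p)" for m
    using nabla2_g[OF assms(2), of k l m] by (simp add: nabla2_def)
  have 1: "(\<Sum>m\<in>UNIV. (\<Sum>s\<in>UNIV. \<Gamma> s k m p * g c l s p) * T c j m p)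
      = (\<Sum>m\<in>UNIV. g c l m p * (\<Sum>s\<in>UNIV. \<Gamma> m k s p * T c j s p))"
    unfolding sum_distrib_left sum_distrib_right by (subst sum.swap) (simp add: mult_ac)
  have 2: "(\<Sum>m\<in>UNIV. (\<Sum>s\<in>UNIV. \<Gamma> s k l p * g c s m p) * T c j m p)
      = (\<Sum>s\<in>UNIV. \<Gamma> s k l p * (\<Sum>m\<in>UNIV. g c s m p * T c j m p))"
    unfolding sum_distrib_left sum_distrib_right by (subst sum.swap) (simp add: mult_ac)
  have 3: "(\<Sum>s\<in>UNIV. \<Gamma> s k j p * (\<Sum>m\<in>UNIV. g c l m p * T c s m p))
      = (\<Sum>m\<in>UNIV. g c l m p * (\<Sum>s\<in>UNIV. \<Gamma> s k j p * T c s m p))"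
    unfolding sum_distrib_left by (subst sum.swap) (simp add: mult_ac)
  have "pd c k (\<lambda>q. \<Sum>m\<in>UNIV. g c l m q * T c j m q) p
      = (\<Sum>m\<in>UNIV. pd c k (g c l m) p * T c j m p + g c l m p * pd c k (T c j m) p)"
    by (simp add: pd_sum pd_mult smooth_mult smooth_g assms)
  then show ?thesis
    by (simp add: nabla2_def nabla_mixed_def pd_g 1 2 3 distrib_left distrib_right
        right_diff_distrib sum.distrib sum_subtractf)
qed

end

section \<open>Divergence-free curvature tensors\<close>

context riemannian_chart
begin

lemma smooth_scaled_g: "smooth_in_chart c (\<lambda>q. scalar_curv g c q * g c k l q)"
  by (intro smooth_intros smooth_scalar_curv smooth_g)

lemma projective_divergence_free:
  assumes p: "p \<in> fst c" and n: "CARD('n) > 3"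
    and div: "(\<Sum>m\<in>UNIV. nabla4 g (projective g) c m j k l m p) = 0"
  shows "nabla2 g (ricci g) c k j l p - nabla2 g (ricci g) c j k l p = 0"
proof -
  let ?L = "\<lambda>c j k l m q. kdelta j m * ricci g c k l q"
  let ?E = "nabla2 g (ricci g) c k j l p - nabla2 g (ricci g) c j k l p"
  have eq: "projective g = (\<lambda>c j k l m q. riemann g c j k l m q
      + 1 / (real CARD('n) - 1) * (?L c j k l m q - ?L c k j l m q))"
    by (simp add: projective_def fun_eq_iff)
  have "0 = (\<Sum>m\<in>UNIV. nabla4 g (riemann g) c m j k l m p
      + 1 / (real CARD('n) - 1) * (nabla4 g ?L c m j k l m p - nabla4 g ?L c m k j l m p))"
    using div unfolding eq
    by (subst (asm) nabla4_add_antisymmetrized)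
       (simp_all add: smooth_mult smooth_const smooth_ricci smooth_riemann p)
  also have "\<dots> = ?E + 1 / (real CARD('n) - 1) * - ?E"
    by (simp only: sum.distrib sum_subtractf sum_distrib_left[symmetric] divergence_riemann
        divergence_kdelta_mult smooth_ricci p minus_diff_eq)
  \<comment> \<open>The coefficient 1 - 1/(n-1) equals (n-2)/(n-1), which is nonzero.\<close>
  finally have "?E * (real CARD('n) - 2) = 0"
    using n by (simp add: field_simps)
  then show ?thesis
    using n by simp
qed

text \<open>As \<open>g\<close> and the Kronecker delta are parallel, the correction to the Riemann
  tensor contributes only the gradient of the scalar curvature.\<close>

lemma concircular_divergence_free:
  assumes p: "p \<in> fst c"
    and div: "(\<Sum>m\<in>UNIV. nabla4 g (concircular g) c m j k l m p) = 0"
  shows "nabla2 g (ricci g) c k j l p - nabla2 g (ricci g) c j k l p =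
    1 / (real CARD('n) * (real CARD('n) - 1)) *
      (pd c k (scalar_curv g c) p * g c j l p - pd c j (scalar_curv g c) p * g c k l p)"
proof -
  let ?L = "\<lambda>c j k l m q. kdelta j m * (scalar_curv g c q * g c k l q)"
  let ?a = "1 / (real CARD('n) * (real CARD('n) - 1))"
  let ?R = "\<lambda>j. pd c j (scalar_curv g c) p"
  have eq: "concircular g = (\<lambda>c j k l m q. riemann g c j k l m q
      + ?a * (?L c j k l m q - ?L c k j l m q))"
    by (simp add: concircular_def fun_eq_iff algebra_simps)
  have L: "(\<Sum>m\<in>UNIV. nabla4 g ?L c m j k l m p) = ?R j * g c k l p" for j k
    by (simp add: divergence_kdelta_mult[where T = "\<lambda>c k l q. scalar_curv g c q * g c k l q"]
        smooth_scaled_g p nabla2_scalar_mult[where f = "scalar_curv g"] smooth_scalar_curv smooth_g nabla2_g)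
  have "0 = (\<Sum>m\<in>UNIV. nabla4 g (riemann g) c m j k l m p
      + ?a * (nabla4 g ?L c m j k l m p - nabla4 g ?L c m k j l m p))"
    using div unfolding eq
    by (subst (asm) nabla4_add_antisymmetrized)
       (simp_all add: smooth_mult smooth_const smooth_scaled_g smooth_riemann p)
  also have "\<dots> = nabla2 g (ricci g) c k j l p - nabla2 g (ricci g) c j k l p
      + ?a * (?R j * g c k l p - ?R k * g c j l p)"
    by (simp only: sum.distrib sum_subtractf sum_distrib_left[symmetric] L divergence_riemann p)
  finally show ?thesis
    by (simp add: algebra_simps)
qed

lemma sum_g_ricci_mixed:
  assumes "p \<in> fst c"
  shows "(\<Sum>m\<in>UNIV. g c l m p * ricci_mixed g c j m p) = ricci g c j l p"
proof -
  have "(\<Sum>m\<in>UNIV. g c l m p * ricci_mixed g c j m p)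
      = (\<Sum>s\<in>UNIV. (\<Sum>m\<in>UNIV. g c l m p * ginv g c m s p) * ricci g c j s p)"
    unfolding ricci_mixed_def sum_distrib_left sum_distrib_right
    by (subst sum.swap) (simp add: mult_ac)
  then show ?thesis
    by (simp add: g_ginv assms)
qed

lemma pd_scalar_curv:
  assumes "p \<in> fst c"
  shows "pd c i (scalar_curv g c) p = (\<Sum>m\<in>UNIV. nabla_mixed (ricci_mixed g) i m m p)"
proof -
  have "scalar_curv g c = (\<lambda>q. \<Sum>m\<in>UNIV. ricci_mixed g c m m q)"
    by (simp add: scalar_curv_def ricci_mixed_def fun_eq_iff)
  then show ?thesis
    using pd_trace[where T = "ricci_mixed g", OF smooth_ricci_mixed assms] by simp
qed

lemma nabla2_ricci:
  assumes p: "p \<in> fst c"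
  shows "nabla2 g (ricci g) c k j l p
    = (\<Sum>m\<in>UNIV. g c l m p * nabla_mixed (ricci_mixed g) k j m p)"
proof -
  have "pd c k (\<lambda>q. \<Sum>m\<in>UNIV. g c l m q * ricci_mixed g c j m q) p = pd c k (ricci g c j l) p"
    by (rule pd_cong[OF p sum_g_ricci_mixed])
  then have "nabla2 g (\<lambda>c j l q. \<Sum>m\<in>UNIV. g c l m q * ricci_mixed g c j m q) c k j l p
      = nabla2 g (ricci g) c k j l p"
    by (simp add: nabla2_def sum_g_ricci_mixed[OF p])
  then show ?thesis
    using nabla2_lower[where T = "ricci_mixed g", OF smooth_ricci_mixed p] by simp
qed

text \<open>The hypothesis brings in the divergence \<open>v\<close> of the Ricci tensor besides its
  antisymmetrized derivative \<open>E\<close>. Tracing the resulting equation relates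
  \<open>v\<close> to the gradient of the scalar curvature and eliminates it.\<close>

lemma conharmonic_divergence_free:
  assumes p: "p \<in> fst c" and n: "CARD('n) > 3"
    and div: "\<And>j k l. (\<Sum>m\<in>UNIV. nabla4 g (conharmonic g) c m j k l m p) = 0"
  shows "nabla2 g (ricci g) c k j l p - nabla2 g (ricci g) c j k l p =
    1 / (2 * real CARD('n) - 4) *
      (pd c k (scalar_curv g c) p * g c j l p - pd c j (scalar_curv g c) p * g c k l p)"
proof -
  let ?L1 = "\<lambda>c j k l m q. kdelta j m * ricci g c k l q"
  let ?L2 = "\<lambda>c j k l m q. ricci_mixed g c j m q * g c k l q"
  let ?L = "\<lambda>c j k l m q. ?L1 c j k l m q + ?L2 c j k l m q"
  let ?n = "real CARD('n)"
  let ?R = "\<lambda>j. pd c j (scalar_curv g c) p"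
  define E where "E k j l = nabla2 g (ricci g) c k j l p - nabla2 g (ricci g) c j k l p" for k j l
  define v where "v j = (\<Sum>m\<in>UNIV. nabla_mixed (ricci_mixed g) m j m p)" for j
  have eq: "conharmonic g = (\<lambda>c j k l m q. riemann g c j k l m q
      + 1 / (?n - 2) * (?L c j k l m q - ?L c k j l m q))"
    by (simp add: conharmonic_def fun_eq_iff algebra_simps)
  have L: "(\<Sum>m\<in>UNIV. nabla4 g ?L c m j k l m p) = nabla2 g (ricci g) c j k l p + v j * g c k l p" for j k l
    by (subst nabla4_add)
       (simp_all add: smooth_intros smooth_ricci smooth_ricci_mixed smooth_g p sum.distrib v_def
         divergence_kdelta_mult divergence_mult_g)
  \<comment> \<open>The delta part of \<open>?L\<close> contributes -E/(n-2), so \<open>E\<close>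
    carries the factor (n-3)/(n-2); the metric part contributes the terms in
    \<open>v\<close>.\<close>
  have E: "(?n - 3) * E k j l = v k * g c j l p - v j * g c k l p" for k j l
  proof -
    have "0 = (\<Sum>m\<in>UNIV. nabla4 g (riemann g) c m j k l m p
        + 1 / (?n - 2) * (nabla4 g ?L c m j k l m p - nabla4 g ?L c m k j l m p))"
      using div[of j k l] unfolding eq
      by (subst (asm) nabla4_add_antisymmetrized)
         (simp_all add: smooth_intros smooth_ricci smooth_ricci_mixed smooth_g smooth_riemann p)
    also have "\<dots> = E k j l + 1 / (?n - 2) * (v j * g c k l p - v k * g c j l p - E k j l)"
      by (simp only: sum.distrib sum_subtractf sum_distrib_left[symmetric] L divergence_riemann p E_def)
         (simp add: algebra_simps)
    finally show ?thesis
      using n by (simp add: field_simps)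
  qed
  have contract: "(\<Sum>k\<in>UNIV. \<Sum>l\<in>UNIV. ginv g c k l p * (\<Sum>m\<in>UNIV. g c l m p * f k m))
      = (\<Sum>k\<in>UNIV. f k k)" for f :: "'n \<Rightarrow> 'n \<Rightarrow> real"
  proof -
    have "(\<Sum>l\<in>UNIV. ginv g c k l p * (\<Sum>m\<in>UNIV. g c l m p * f k m))
        = (\<Sum>m\<in>UNIV. (\<Sum>l\<in>UNIV. ginv g c k l p * g c l m p) * f k m)" for k
      unfolding sum_distrib_left sum_distrib_right by (subst sum.swap) (simp add: mult_ac)
    then show ?thesis
      by (simp add: g_ginv p)
  qed
  \<comment> \<open>Contracting over \<open>k\<close> and \<open>l\<close> turns \<open>E\<close>
    into \<open>v j - ?R j\<close> and the right-hand side of the equation for \<open>E\<close> into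
    (1-n) \<open>v j\<close>.\<close>
  have vR: "(2 * ?n - 4) * v j = (?n - 3) * ?R j" for j
  proof -
    let ?N = "nabla_mixed (ricci_mixed g)"
    have "(\<Sum>k\<in>UNIV. \<Sum>l\<in>UNIV. ginv g c k l p * E k j l)
        = (\<Sum>k\<in>UNIV. \<Sum>l\<in>UNIV. ginv g c k l p * (\<Sum>m\<in>UNIV. g c l m p * (?N k j m p - ?N j k m p)))"
      by (simp add: E_def nabla2_ricci p right_diff_distrib sum_subtractf)
    also have "\<dots> = v j - ?R j"
      by (subst contract) (simp add: v_def pd_scalar_curv p sum_subtractf)
    finally have 1: "(\<Sum>k\<in>UNIV. \<Sum>l\<in>UNIV. ginv g c k l p * E k j l) = v j - ?R j" .
    have "(?n - 3) * (\<Sum>k\<in>UNIV. \<Sum>l\<in>UNIV. ginv g c k l p * E k j l)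
        = (\<Sum>k\<in>UNIV. \<Sum>l\<in>UNIV. ginv g c k l p * (v k * g c j l p - v j * g c k l p))"
      by (simp add: sum_distrib_left mult.left_commute[of "?n - 3"] E)
    \<comment> \<open>The metric components are written as lowered Kronecker deltas, which brings
      the sum into the shape handled by \<open>contract\<close>.\<close>
    also have "\<dots> = (\<Sum>k\<in>UNIV. \<Sum>l\<in>UNIV. ginv g c k l p * (\<Sum>m\<in>UNIV. g c l m p * (v k * kdelta m j - v j * kdelta m k)))"
    proof (intro sum.cong refl arg_cong[where f = "(*) _"])
      fix k l
      have "(\<Sum>m\<in>UNIV. g c l m p * (v k * kdelta m j - v j * kdelta m k))
          = v k * (\<Sum>m\<in>UNIV. g c l m p * kdelta m j) - v j * (\<Sum>m\<in>UNIV. g c l m p * kdelta m k)"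
        by (simp only: right_diff_distrib sum_subtractf sum_distrib_left mult.left_commute)
      then show "v k * g c j l p - v j * g c k l p
          = (\<Sum>m\<in>UNIV. g c l m p * (v k * kdelta m j - v j * kdelta m k))"
        by (simp add: g_sym[OF p, of l j] g_sym[OF p, of l k])
    qed
    also have "\<dots> = v j - ?n * v j"
      by (subst contract) (simp add: sum_subtractf, simp add: kdelta_def)
    finally show ?thesis
      unfolding 1 by (simp add: algebra_simps)
  qed
  \<comment> \<open>Multiplying by 2n-4 allows \<open>v\<close> to be replaced; the common factor
    n-3 then cancels because n > 3.\<close>
  have "(2 * ?n - 4) * ((?n - 3) * E k j l) = ((2 * ?n - 4) * v k) * g c j l p - ((2 * ?n - 4) * v j) * g c k l p"
    by (simp only: E right_diff_distrib mult.assoc)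
  also have "\<dots> = (?n - 3) * (?R k * g c j l p - ?R j * g c k l p)"
    by (simp only: vR right_diff_distrib mult.assoc)
  finally have "(?n - 3) * ((2 * ?n - 4) * E k j l) = (?n - 3) * (?R k * g c j l p - ?R j * g c k l p)"
    by (simp only: mult.left_commute)
  then have "(2 * ?n - 4) * E k j l = ?R k * g c j l p - ?R j * g c k l p"
    using n by simp
  then show ?thesis
    using n by (simp add: E_def[symmetric] field_simps)
qed

section \<open>The exterior covariant derivative\<close>

text \<open>A tensor \<open>Y\<^sub>j\<^sub>l\<close> is regarded as a 1-form in \<open>j\<close> with values in covectors. The lemma is
  the Leibniz rule \<open>d(w \<and> Y) = dw \<and> Y - w \<and> dY\<close>; by torsion-freeness the Christoffel terms
  that act on the form indices are dropped.\<close>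

lemma exterior_derivative_wedge:
  fixes w :: "'n \<Rightarrow> 'a \<Rightarrow> real" and Y :: "('a, 'n) tensor2" and l :: 'n
  assumes p: "p \<in> fst c" and w: "\<And>i. smooth_in_chart c (w i)"
    and Y: "\<And>i j. smooth_in_chart c (Y c i j)"
  defines "H \<equiv> \<lambda>k j l q. w k q * Y c j l q - w j q * Y c k l q"
  defines "D \<equiv> \<lambda>i k j. pd c i (H k j l) p - (\<Sum>s\<in>UNIV. \<Gamma> s i l p * H k j s p)"
  defines "S \<equiv> \<lambda>k j. nabla2 g Y c k j l p - nabla2 g Y c j k l p"
  shows "D i k j + D k j i + D j i k =
    (pd c i (w k) p - pd c k (w i) p) * Y c j l p + (pd c k (w j) p - pd c j (w k) p) * Y c i l p
    + (pd c j (w i) p - pd c i (w j) p) * Y c k l p - (w i p * S k j + w k p * S j i + w j p * S i k)"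
proof -
  have *: "D i k j = pd c i (w k) p * Y c j l p - pd c i (w j) p * Y c k l p
      + w k p * (pd c i (Y c j l) p - (\<Sum>s\<in>UNIV. \<Gamma> s i l p * Y c j s p))
      - w j p * (pd c i (Y c k l) p - (\<Sum>s\<in>UNIV. \<Gamma> s i l p * Y c k s p))" for i k j
    by (simp add: D_def H_def pd_diff pd_mult smooth_mult w Y p right_diff_distrib
        sum_subtractf sum_distrib_left mult.left_commute)
  then show ?thesis
    unfolding * S_def nabla2_antisym[OF p] by (simp add: algebra_simps)
qed

text \<open>Both expressions for dZ hold on the whole chart, so they may be differentiated.
  Comparing the results gives a cyclic identity between dw and \<open>Z\<close>, from which the
  inverse of \<open>Z\<close> extracts one component of dw.\<close>

lemma closed_if_wedge_eq_gradient_wedge: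
  assumes p: "p \<in> fst c" and w: "\<And>i. smooth_in_chart c (w i)"
    and Z: "\<And>i j. smooth_in_chart c (Z c i j)" and f: "smooth_in_chart c f"
    and dZ: "\<And>q k j l. q \<in> fst c \<Longrightarrow>
      nabla2 g Z c k j l q - nabla2 g Z c j k l q = w k q * Z c j l q - w j q * Z c k l q"
    and dZ': "\<And>q k j l. q \<in> fst c \<Longrightarrow>
      nabla2 g Z c k j l q - nabla2 g Z c j k l q = pd c k f q * g c j l q - pd c j f q * g c k l q"
    and inv: "\<And>h l. (\<Sum>k\<in>UNIV. Zinv k h * Z c k l p) = kdelta h l"
    and Z_sym: "\<And>k l. Z c k l p = Z c l k p"
    and n: "CARD('n) > 2"
  shows "pd c i (w k) p = pd c k (w i) p"
proof (cases "i = k")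
  case False
  \<comment> \<open>A third index distinct from \<open>i\<close> and \<open>k\<close> is needed for
    the final contraction; it exists since n > 2.\<close>
  have "card {i, k} < CARD('n)"
    using n by (auto simp: card_insert_if)
  then have "{i, k} \<noteq> UNIV"
    by auto
  then obtain j where j: "j \<noteq> i" "j \<noteq> k"
    by blast
  have eq: "w k q * Z c j l q - w j q * Z c k l q = pd c k f q * g c j l q - pd c j f q * g c k l q"
    if "q \<in> fst c" for q k j l
    using dZ[OF that] dZ'[OF that] by simp
  have pd_eq: "pd c i (\<lambda>q. w k q * Z c j l q - w j q * Z c k l q) p
      = pd c i (\<lambda>q. pd c k f q * g c j l q - pd c j f q * g c k l q) p" for i k j l
    by (rule pd_cong[OF p eq])
  have *: "(pd c i (w k) p - pd c k (w i) p) * Z c l j p + (pd c k (w j) p - pd c j (w k) p) * Z c l i p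
    + (pd c j (w i) p - pd c i (w j) p) * Z c l k p = 0" for l
  proof -
    let ?D = "\<lambda>H i k j. pd c i (H k j l) p - (\<Sum>s\<in>UNIV. \<Gamma> s i l p * H k j s p)"
    let ?H = "\<lambda>k j l q. w k q * Z c j l q - w j q * Z c k l q"
    let ?G = "\<lambda>k j l q. pd c k f q * g c j l q - pd c j f q * g c k l q"
    have "?D ?H i k j + ?D ?H k j i + ?D ?H j i k = ?D ?G i k j + ?D ?G k j i + ?D ?G j i k"
      by (simp only: pd_eq eq[OF p])
    \<comment> \<open>Both parts of the Leibniz rule vanish: the Hessian of \<open>f\<close> is
      symmetric and the metric is parallel.\<close>
    also have "\<dots> = 0"
      using exterior_derivative_wedge[where Y = g and w = "\<lambda>i. pd c i f", OF p smooth_pd[OF f] smooth_g]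
      by (simp add: nabla2_g[OF p] pd_commute[OF f p, of k i] pd_commute[OF f p, of j i]
          pd_commute[OF f p, of k j])
    finally have "?D ?H i k j + ?D ?H k j i + ?D ?H j i k = 0" .
    \<comment> \<open>Substituting dZ by the wedge of \<open>w\<close> with \<open>Z\<close> makes
      the second part of the Leibniz rule a wedge of \<open>w\<close> with itself, which is
      zero.\<close>
    moreover have "?D ?H i k j + ?D ?H k j i + ?D ?H j i k =
      (pd c i (w k) p - pd c k (w i) p) * Z c j l p + (pd c k (w j) p - pd c j (w k) p) * Z c i l p
      + (pd c j (w i) p - pd c i (w j) p) * Z c k l p"
      by (subst exterior_derivative_wedge[where Y = Z and w = w, OF p w Z])
         (simp add: dZ[OF p] algebra_simps)
    ultimately show ?thesis
      by (simp only: Z_sym[of l])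
  qed
  \<comment> \<open>Contraction with column \<open>j\<close> of the inverse turns the three
    components of \<open>Z\<close> into deltas, of which only the first survives, as
    \<open>j\<close> differs from \<open>i\<close> and \<open>k\<close>.\<close>
  have "0 = (\<Sum>l\<in>UNIV. Zinv l j * ((pd c i (w k) p - pd c k (w i) p) * Z c l j p
      + (pd c k (w j) p - pd c j (w k) p) * Z c l i p + (pd c j (w i) p - pd c i (w j) p) * Z c l k p))"
    by (simp add: *)
  also have "\<dots> = (pd c i (w k) p - pd c k (w i) p) * kdelta j j
      + (pd c k (w j) p - pd c j (w k) p) * kdelta j i + (pd c j (w i) p - pd c i (w j) p) * kdelta j k"
    unfolding inv[symmetric] by (simp add: sum_distrib_left sum.distrib[symmetric] algebra_simps)
  finally show ?thesis
    using j by (simp add: kdelta_def)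
qed simp

end

section \<open>From the manifold to a chart, and the theorem\<close>

lemma riemannian_manifold_imp_riemannian_chart:
  assumes "riemannian_manifold X Atl g" "c \<in> Atl"
  shows "riemannian_chart c g"
proof -
  interpret coordinate_chart c
    using assms
    by (intro is_chart_imp_coordinate_chart[of X]) (simp add: riemannian_manifold_def smooth_manifold_def)
  show ?thesis
    by unfold_locales (use assms in \<open>auto simp: riemannian_manifold_def tensor_field_0_2_def\<close>)
qed

theorem corollary4p9:
  fixes X :: "'a topology"
    and Atl :: "('a, 'n::finite) chart set"
    and g :: "('a, 'n) tensor2"
    and \<phi> :: "'a \<Rightarrow> real"
    and A B D \<omega> :: "('a, 'n) tensor1"
    and K :: "('a, 'n) tensor4"
  assumes manifold: "riemannian_manifold X Atl g"
    and dim: "CARD('n) > 3"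
    and WZS: "weakly_Z_symmetric Atl g \<phi> A B D"
    and nonsing: "nonsingular Atl (Z_tensor g \<phi>)"
    and omega: "\<And>c k p. \<omega> c k p = A c k p - B c k p"
    and omega_nonzero: "\<exists>c\<in>Atl. \<exists>p\<in>fst c. \<exists>k. \<omega> c k p \<noteq> 0"
    and K: "K = projective g \<or> K = concircular g \<or> K = conharmonic g"
    and div_K: "divergence_free Atl g K"
  shows "closed_1form Atl g \<omega>"
  unfolding closed_1form_def
proof (intro ballI allI)
  fix c p i j assume c: "c \<in> Atl" and p: "p \<in> fst c"
  interpret riemannian_chart c g
    using manifold c by (rule riemannian_manifold_imp_riemannian_chart)
  let ?Z = "Z_tensor g \<phi>" and ?R = "scalar_curv g c"
  have \<phi>: "smooth_in_chart c \<phi>"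
    using WZS c by (simp add: weakly_Z_symmetric_def scalar_field_def)
  have \<omega>: "smooth_in_chart c (\<omega> c k)" for k
  proof -
    have "smooth_in_chart c (\<lambda>q. A c k q - B c k q)"
      using WZS c by (intro smooth_diff) (auto simp: weakly_Z_symmetric_def covector_field_def)
    then show ?thesis
      by (simp add: omega[symmetric])
  qed
  have Z: "smooth_in_chart c (?Z c k l)" for k l
    unfolding Z_tensor_def[abs_def] by (intro smooth_intros \<phi> smooth_ricci smooth_g)
  have Z_sym: "?Z c k l q = ?Z c l k q" if "q \<in> fst c" for q k l
    by (simp add: Z_tensor_def ricci_sym[OF that, of k l] g_sym[OF that, of k l])
  \<comment> \<open>The term with \<open>D\<close> is symmetric in \<open>k\<close> and
    \<open>j\<close> because \<open>Z\<close> is, so antisymmetrization leaves only A - B.\<close>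
  have \<omega>_wedge: "nabla2 g ?Z c k j l q - nabla2 g ?Z c j k l q = \<omega> c k q * ?Z c j l q - \<omega> c j q * ?Z c k l q"
    if q: "q \<in> fst c" for q k j l
  proof -
    have "nabla2 g ?Z c k j l q = A c k q * ?Z c j l q + B c j q * ?Z c k l q + D c l q * ?Z c k j q" for k j l
      using WZS c q by (auto simp: weakly_Z_symmetric_def)
    then show ?thesis
      by (simp add: omega Z_sym[OF q, of k j] algebra_simps)
  qed
  \<comment> \<open>The constant is 0 for the projective, 1/(n(n-1)) for the concircular and
    1/(2n-4) for the conharmonic tensor. It is the same at all points, so it can be taken inside the
    gradient.\<close>
  obtain a where a: "nabla2 g (ricci g) c k j l q - nabla2 g (ricci g) c j k l q
      = a * (pd c k ?R q * g c j l q - pd c j ?R q * g c k l q)" if "q \<in> fst c" for q k j l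
  proof -
    have div: "(\<Sum>m\<in>UNIV. nabla4 g K c m j k l m q) = 0" if "q \<in> fst c" for q j k l
      using div_K c that by (simp add: divergence_free_def)
    from K show thesis
    proof (elim disjE)
      assume "K = projective g"
      then show thesis
        using projective_divergence_free[OF _ dim div[unfolded \<open>K = projective g\<close>]]
        by (intro that[of 0]) simp
    next
      assume "K = concircular g"
      then show thesis
        using concircular_divergence_free[OF _ div[unfolded \<open>K = concircular g\<close>]]
        by (intro that) blast
    next
      assume "K = conharmonic g"
      then show thesis
        using conharmonic_divergence_free[OF _ dim div[unfolded \<open>K = conharmonic g\<close>]]
        by (intro that) blast
    qed
  qed
  \<comment> \<open>The gradient of \<phi> comes from the metric part of \<open>Z\<close>, that of
    the scalar curvature from its Ricci part.\<close>
  define f where "f q = \<phi> q + a * ?R q" for q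
  have f: "smooth_in_chart c f"
    unfolding f_def[abs_def] by (intro smooth_intros \<phi> smooth_scalar_curv)
  have gradient_wedge: "nabla2 g ?Z c k j l q - nabla2 g ?Z c j k l q = pd c k f q * g c j l q - pd c j f q * g c k l q"
    if q: "q \<in> fst c" for q k j l
  proof -
    have "nabla2 g ?Z c k j l q = nabla2 g (ricci g) c k j l q + pd c k \<phi> q * g c j l q" for k j l
      unfolding Z_tensor_def[abs_def]
      using nabla2_add[where S = "ricci g" and T = "\<lambda>c k l q. \<phi> q * g c k l q", OF smooth_ricci _ q]
        nabla2_scalar_mult[where f = "\<lambda>c. \<phi>" and T = g, OF \<phi> smooth_g q]
      by (simp add: smooth_mult \<phi> smooth_g nabla2_g[OF q])
    then show ?thesis
      using a[OF q, of k j l]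
      by (simp add: f_def[abs_def] pd_add pd_cmult smooth_intros \<phi> smooth_scalar_curv q algebra_simps)
  qed
  obtain Zinv where "\<And>h l. (\<Sum>k\<in>UNIV. Zinv c k h p * ?Z c k l p) = kdelta h l"
    using nonsing c p unfolding nonsingular_def by blast
  then have "pd c i (\<omega> c j) p = pd c j (\<omega> c i) p"
    using dim by (intro closed_if_wedge_eq_gradient_wedge[where Z = ?Z and Zinv = "\<lambda>k h. Zinv c k h p" and f = f]
      p \<omega> Z f \<omega>_wedge gradient_wedge Z_sym) auto
  \<comment> \<open>By symmetry of the Christoffel symbols the antisymmetrized covariant derivative
    equals the antisymmetrized partial derivative.\<close>
  then show "nabla1 g \<omega> c i j p - nabla1 g \<omega> c j i p = 0"
    by (simp add: nabla1_def christoffel_sym[OF p, of _ i j])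
qed

end
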